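(* Let $G$ be a Lie group with identity element $e$ and Lie algebra $\mathfrak{g}$. If $\mathfrak{B}:\mathfrak{g}\rightarrow G$ is a smooth pointed (i.e. $\mathfrak{B}(0)=e$) relative averaging operator on $G$ with respect to the adjoint representation on $\mathfrak{g}$, then $P=\mathfrak{B}_{*0}:\mathfrak{g}\rightarrow\mathfrak{g}$ (the differential of $\mathfrak{B}$ at $0$) is an averaging operator on the Lie algebra $\mathfrak{g}$.
   Context: The adjoint representation of $G$ on $\mathfrak{g}$ is $\mathrm{Ad}:G\times\mathfrak{g}\to\mathfrak{g}$, where $\mathrm{Ad}_g:\mathfrak{g}\to\mathfrak{g}$ is the differential at $e$ of the conjugation map $h\mapsto ghg^{-1}$. A relative averaging operator on $G$ with respect to the adjoint representation is a map $\mathfrak{B}:\mathfrak{g}\to G$ satisfying $\mathfrak{B}(x)\mathfrak{B}(y)\mathfrak{B}(x)^{-1} = \mathfrak{B}(\mathrm{Ad}_{\mathfrak{B}(x)}y)$ for all $x,y\in\mathfrak{g}$. The tangent spaces $T_0\mathfrak{g}$ and $T_eG$ are identified with $\mathfrak{g}$. An averaging operator on a Lie algebra $(\mathfrak{g},[~,~])$ is a linear map $P:\mathfrak{g}\to\mathfrak{g}$ satisfying $[P(x),P(y)] = P[P(x),y]$ for all $x,y\in\mathfrak{g}$. *)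

theory Defs
  imports "HOL-Analysis.Analysis" "HOL-Algebra.Group"
begin

section \<open>Smooth functions between open subsets of normed spaces\<close>

text \<open>The predicates below are only meant for open subsets of finite-dimensional spaces, where
  iterated differentiability of all directional derivatives is the usual notion of class
  \<open>C\<^sup>\<infinity>\<close>.\<close>

primrec Ck_on ::
  "nat \<Rightarrow> 'a::real_normed_vector set \<Rightarrow> ('a \<Rightarrow> 'b::real_normed_vector) \<Rightarrow> bool" where
  "Ck_on 0 S f \<longleftrightarrow> continuous_on S f"
| "Ck_on (Suc k) S f \<longleftrightarrow> (\<forall>x\<in>S. f differentiable (at x)) \<and>
     (\<forall>v. Ck_on k S (\<lambda>x. frechet_derivative f (at x) v))"

definition smooth_on ::
  "'a::real_normed_vector set \<Rightarrow> ('a \<Rightarrow> 'b::real_normed_vector) \<Rightarrow> bool" where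
  "smooth_on S f \<longleftrightarrow> (\<forall>k. Ck_on k S f)"


section \<open>Smooth manifolds\<close>

text \<open>A manifold is modelled on a finite-dimensional inner product space \<open>'e\<close>, i.e. on
  \<open>\<real>\<^sup>n\<close> without chosen coordinates. The class \<open>euclidean_space\<close> is not used
  because it excludes \<open>n = 0\<close>. A chart is a pair of its domain and a map which is
  relevant on that domain only.\<close>

record ('m, 'e) manifold =
  mtop :: "'m topology"
  charts :: "('m set \<times> ('m \<Rightarrow> 'e)) set"

locale smooth_manifold =
  fixes M :: "('m, 'e::real_inner) manifold"
  assumes finite_dim: "\<exists>B::'e set. finite B \<and> span B = UNIV"
    and Hausdorff: "Hausdorff_space (mtop M)"
    and second_countable: "second_countable (mtop M)"
    and chart_open: "(U, \<phi>) \<in> charts M \<Longrightarrow> openin (mtop M) U \<and> open (\<phi> ` U)"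
    and chart_homeo: "(U, \<phi>) \<in> charts M \<Longrightarrow>
      homeomorphic_map (subtopology (mtop M) U) (top_of_set (\<phi> ` U)) \<phi>"
    and charts_cover: "topspace (mtop M) = (\<Union>(U, \<phi>)\<in>charts M. U)"
    and charts_compatible: "(U, \<phi>) \<in> charts M \<Longrightarrow> (V, \<psi>) \<in> charts M \<Longrightarrow>
      smooth_on (\<phi> ` (U \<inter> V)) (\<psi> \<circ> inv_into U \<phi>)"

definition smooth_map_on :: "'m set \<Rightarrow> ('m, 'd::real_inner) manifold \<Rightarrow>
    ('n, 'e::real_inner) manifold \<Rightarrow> ('m \<Rightarrow> 'n) \<Rightarrow> bool" where
  "smooth_map_on W M N F \<longleftrightarrow>
     openin (mtop M) W \<and> continuous_map (subtopology (mtop M) W) (mtop N) F \<and>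
     (\<forall>(U, \<phi>)\<in>charts M. \<forall>(V, \<psi>)\<in>charts N.
        smooth_on (\<phi> ` {p \<in> U \<inter> W. F p \<in> V}) (\<psi> \<circ> F \<circ> inv_into U \<phi>))"

definition euclid :: "('e::real_inner, 'e) manifold" where
  "euclid = \<lparr>mtop = euclidean, charts = {(UNIV, \<lambda>x. x)}\<rparr>"

definition prod_manifold :: "('m, 'd) manifold \<Rightarrow> ('n, 'e) manifold \<Rightarrow>
    ('m \<times> 'n, 'd \<times> 'e) manifold" where
  "prod_manifold M N = \<lparr>mtop = prod_topology (mtop M) (mtop N),
     charts = {(U \<times> V, map_prod \<phi> \<psi>) | U V \<phi> \<psi>. (U, \<phi>) \<in> charts M \<and> (V, \<psi>) \<in> charts N}\<rparr>"


section \<open>Tangent vectors and differentials\<close>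

definition smooth_near :: "('m, 'e::real_inner) manifold \<Rightarrow> 'm \<Rightarrow> ('m \<Rightarrow> real) \<Rightarrow> bool" where
  "smooth_near M p f \<longleftrightarrow> (\<exists>W. p \<in> W \<and> smooth_map_on W M euclid f)"

text \<open>A tangent vector at \<open>p\<close> is the directional derivative, along a smooth curve through \<open>p\<close>,
  acting on the functions that are smooth near \<open>p\<close>. Tangent vectors take the value 0 at all
  other functions, so that equality of tangent vectors is equality of functionals; the vector space
  operations are pointwise.\<close>

type_synonym 'm tvec = "('m \<Rightarrow> real) \<Rightarrow> real"

definition velocity :: "('m, 'e::real_inner) manifold \<Rightarrow> (real \<Rightarrow> 'm) \<Rightarrow> 'm tvec" where
  "velocity M c = (\<lambda>f. if smooth_near M (c 0) f then deriv (\<lambda>t. f (c t)) 0 else 0)"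

definition tangent_space :: "('m, 'e::real_inner) manifold \<Rightarrow> 'm \<Rightarrow> 'm tvec set" where
  "tangent_space M p =
     {velocity M c | c. c 0 = p \<and> (\<exists>\<epsilon>>0. smooth_map_on {-\<epsilon><..<\<epsilon>} euclid M c)}"

text \<open>The differential at \<open>p\<close> of a map \<open>F\<close> into \<open>N\<close>.\<close>

definition differential :: "('n, 'e::real_inner) manifold \<Rightarrow> ('m \<Rightarrow> 'n) \<Rightarrow> 'm \<Rightarrow>
    'm tvec \<Rightarrow> 'n tvec" where
  "differential N F p v = (\<lambda>f. if smooth_near N (F p) f then v (f \<circ> F) else 0)"

text \<open>The bracket \<open>[X, Y]\<^sub>p f = X\<^sub>p (Y f) - Y\<^sub>p (X f)\<close> of vector fields.\<close>

definition field_bracket :: "('m, 'e::real_inner) manifold \<Rightarrow> ('m \<Rightarrow> 'm tvec) \<Rightarrow>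
    ('m \<Rightarrow> 'm tvec) \<Rightarrow> 'm \<Rightarrow> 'm tvec" where
  "field_bracket M X Y p =
     (\<lambda>f. if smooth_near M p f then X p (\<lambda>q. Y q f) - Y p (\<lambda>q. X q f) else 0)"


section \<open>Finite-dimensional vector spaces as manifolds\<close>

text \<open>Spaces of real-valued functions (such as tangent spaces) are considered with the pointwise
  operations. The charts of such a space \<open>V\<close> are the inverses of all linear isomorphisms
  from the model space onto \<open>V\<close>, and its topology is the one determined by these charts.\<close>

definition linear_iso :: "('e::real_vector \<Rightarrow> 'b \<Rightarrow> real) \<Rightarrow> ('b \<Rightarrow> real) set \<Rightarrow> bool" where
  "linear_iso L V \<longleftrightarrow> bij_betw L UNIV V \<and>
     (\<forall>a b u v. L (a *\<^sub>R u + b *\<^sub>R v) = (\<lambda>s. a * L u s + b * L v s))"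

definition linear_charts ::
  "('b \<Rightarrow> real) set \<Rightarrow> (('b \<Rightarrow> real) set \<times> (('b \<Rightarrow> real) \<Rightarrow> 'e::real_inner)) set" where
  "linear_charts V = {(V, inv_into UNIV L) | L. linear_iso L V}"

definition linear_manifold :: "('b \<Rightarrow> real) set \<Rightarrow> ('b \<Rightarrow> real, 'e::real_inner) manifold" where
  "linear_manifold V =
     \<lparr>mtop = topology (\<lambda>S. S \<subseteq> V \<and>
        (\<forall>(U, \<phi>)\<in>(linear_charts V :: (('b \<Rightarrow> real) set \<times> (('b \<Rightarrow> real) \<Rightarrow> 'e)) set). open (\<phi> ` S))),
      charts = linear_charts V\<rparr>"


section \<open>Lie groups and their Lie algebras\<close>

locale lie_group = group G + smooth_manifold M
  for G :: "'g monoid" (structure) and M :: "('g, 'e::real_inner) manifold" +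
  assumes topspace_eq_carrier: "topspace (mtop M) = carrier G"
    and smooth_mult: "smooth_map_on (carrier G \<times> carrier G) (prod_manifold M M) M (\<lambda>(g, h). g \<otimes> h)"
    and smooth_inv: "smooth_map_on (carrier G) M M (\<lambda>g. inv g)"

definition lie_algebra :: "'g monoid \<Rightarrow> ('g, 'e::real_inner) manifold \<Rightarrow> 'g tvec set" where
  "lie_algebra G M = tangent_space M \<one>\<^bsub>G\<^esub>"

definition left_invariant_field ::
  "'g monoid \<Rightarrow> ('g, 'e::real_inner) manifold \<Rightarrow> 'g tvec \<Rightarrow> 'g \<Rightarrow> 'g tvec" where
  "left_invariant_field G M x g = differential M (\<lambda>h. g \<otimes>\<^bsub>G\<^esub> h) \<one>\<^bsub>G\<^esub> x"

definition lie_bracket ::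
  "'g monoid \<Rightarrow> ('g, 'e::real_inner) manifold \<Rightarrow> 'g tvec \<Rightarrow> 'g tvec \<Rightarrow> 'g tvec" where
  "lie_bracket G M x y =
     field_bracket M (left_invariant_field G M x) (left_invariant_field G M y) \<one>\<^bsub>G\<^esub>"

definition Ad ::
  "'g monoid \<Rightarrow> ('g, 'e::real_inner) manifold \<Rightarrow> 'g \<Rightarrow> 'g tvec \<Rightarrow> 'g tvec" where
  "Ad G M g = differential M (\<lambda>h. g \<otimes>\<^bsub>G\<^esub> h \<otimes>\<^bsub>G\<^esub> inv\<^bsub>G\<^esub> g) \<one>\<^bsub>G\<^esub>"

definition lie_algebra_manifold ::
  "'g monoid \<Rightarrow> ('g, 'e::real_inner) manifold \<Rightarrow> ('g tvec, 'e) manifold" where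
  "lie_algebra_manifold G M = linear_manifold (lie_algebra G M)"

text \<open>The zero vector of the Lie algebra is \<open>\<lambda>f. 0\<close>. The Lie algebra is identified with its
  tangent space at 0 by sending \<open>v\<close> to the velocity of the line \<open>t \<mapsto> t v\<close>.\<close>

definition tangent_at_zero ::
  "'g monoid \<Rightarrow> ('g, 'e::real_inner) manifold \<Rightarrow> 'g tvec \<Rightarrow> 'g tvec tvec" where
  "tangent_at_zero G M v = velocity (lie_algebra_manifold G M) (\<lambda>t f. t * v f)"

definition differential_at_zero ::
  "'g monoid \<Rightarrow> ('g, 'e::real_inner) manifold \<Rightarrow> ('g tvec \<Rightarrow> 'g) \<Rightarrow> 'g tvec \<Rightarrow> 'g tvec" where
  "differential_at_zero G M \<BB> v = differential M \<BB> (\<lambda>f. 0) (tangent_at_zero G M v)"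


section \<open>Averaging operators\<close>

definition relative_averaging_operator ::
  "'g monoid \<Rightarrow> ('g, 'e::real_inner) manifold \<Rightarrow> ('g tvec \<Rightarrow> 'g) \<Rightarrow> bool" where
  "relative_averaging_operator G M \<BB> \<longleftrightarrow> \<BB> \<in> lie_algebra G M \<rightarrow> carrier G \<and>
     (\<forall>x\<in>lie_algebra G M. \<forall>y\<in>lie_algebra G M.
        \<BB> x \<otimes>\<^bsub>G\<^esub> \<BB> y \<otimes>\<^bsub>G\<^esub> inv\<^bsub>G\<^esub> (\<BB> x) = \<BB> (Ad G M (\<BB> x) y))"

definition averaging_operator :: "('b \<Rightarrow> real) set \<Rightarrow>
    (('b \<Rightarrow> real) \<Rightarrow> ('b \<Rightarrow> real) \<Rightarrow> ('b \<Rightarrow> real)) \<Rightarrow> (('b \<Rightarrow> real) \<Rightarrow> ('b \<Rightarrow> real)) \<Rightarrow> bool" where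
  "averaging_operator V br P \<longleftrightarrow> P \<in> V \<rightarrow> V \<and>
     (\<forall>x\<in>V. \<forall>y\<in>V. \<forall>a b. P (\<lambda>s. a * x s + b * y s) = (\<lambda>s. a * P x s + b * P y s)) \<and>
     (\<forall>x\<in>V. \<forall>y\<in>V. br (P x) (P y) = P (br (P x) y))"

end

theory Submission imports Defs begin

text \<open>In a chart at the identity, the Lie algebra is the model space \<open>\<real>\<^sup>n\<close>. Write \<open>\<kappa> (u, v)\<close> for
  conjugation \<open>u v u\<inverse>\<close>, \<open>A u = \<partial>\<^sub>v \<kappa> (u, e)\<close> for the adjoint representation and \<open>\<beta>\<close> for the
  coordinate expression of \<open>\<BB>\<close>. Differentiating
  \<open>\<kappa> (\<beta> x, \<beta> y) = \<beta> (A (\<beta> x) y)\<close> at \<open>y = 0\<close> gives \<open>A (\<beta> x) (\<beta>' y) = \<beta>' (A (\<beta> x) y)\<close>, and then at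
  \<open>x = 0\<close> gives \<open>[\<beta>' x, \<beta>' y] = \<beta>' [\<beta>' x, y]\<close>, because the derivative of \<open>A\<close> at the identity is the
  Lie bracket. The latter fact follows from \<open>(u v u\<inverse>) u = u v\<close> and the symmetry of second
  derivatives.\<close>

section \<open>Finite-dimensional spaces\<close>

text \<open>The objects of the statement are functionals on functions near a point, with the value 0
  on functions that are not smooth there, and coordinates on the group exist only near the identity.
  Two devices deal with this. The parametrization \<open>tvec\<close> of the tangent space by the
  model space is itself one of the linear isomorphisms that define the charts of
  \<open>lie_algebra_manifold\<close>, so smoothness of \<beta> can be read off from that of \<BB>.
  Coordinate identities are stated for germs (\<open>eventually\<close> in \<open>nhds\<close>),
  which suffices because derivatives depend on germs only. The identity at y = 0 has to be obtained
  for all x near 0 before x is differentiated. There y |-> A (\<beta> x) y is linear and fixes 0, so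
  on both sides \<beta> is differentiated at 0 only. For the bracket, multiplying the conjugate by u
  on the right cancels the inverse, so the derivative of inversion is never computed. Finite
  dimension is carried by \<open>fin_dim\<close>, a predicate on types that passes to products; the
  composition of \<open>Ck_on\<close> functions relies on it.\<close>

definition fin_dim :: "'a::real_vector itself \<Rightarrow> bool" where
  "fin_dim _ \<longleftrightarrow> (\<exists>B::'a set. finite B \<and> span B = UNIV)"

lemma fin_dim_prod:
  assumes "fin_dim TYPE('a::real_vector)" "fin_dim TYPE('b::real_vector)"
  shows "fin_dim TYPE('a \<times> 'b)"
proof -
  obtain A :: "'a set" and B :: "'b set"
    where AB: "finite A" "span A = UNIV" "finite B" "span B = UNIV"
    using assms unfolding fin_dim_def by auto
  have "span (A \<times> {0} \<union> {0} \<times> B) = UNIV" (is "span ?C = _")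
  proof (rule UNIV_eq_I[symmetric])
    fix p :: "'a \<times> 'b"
    have "(fst p, 0) \<in> span ?C"
    proof -
      have "fst p \<in> span A" using AB by simp
      then show ?thesis
      proof (induction rule: span_induct_alt)
        case (step c x y)
        have "(x, 0) \<in> span ?C" using step by (auto intro: span_base)
        with step have "c *\<^sub>R (x, 0) + (y, 0) \<in> span ?C" by (blast intro: span_add span_scale)
        then show ?case by simp
      qed (simp add: span_zero flip: zero_prod_def)
    qed
    moreover have "(0, snd p) \<in> span ?C"
    proof -
      have "snd p \<in> span B" using AB by simp
      then show ?thesis
      proof (induction rule: span_induct_alt)
        case (step c x y)
        have "(0, x) \<in> span ?C" using step by (auto intro: span_base)
        with step have "c *\<^sub>R (0, x) + (0, y) \<in> span ?C" by (blast intro: span_add span_scale)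
        then show ?case by simp
      qed (simp add: span_zero flip: zero_prod_def)
    qed
    ultimately have "(fst p, 0) + (0, snd p) \<in> span ?C" by (rule span_add)
    then show "p \<in> span ?C" by simp
  qed
  with AB show ?thesis unfolding fin_dim_def by (metis finite.emptyI finite.insertI finite_SigmaI finite_UnI)
qed

text \<open>An orthogonal spanning set makes each coordinate an inner product divided by a squared
  norm, hence visibly bounded.\<close>

lemma fin_dim_coordinates:
  assumes "fin_dim TYPE('a::real_inner)"
  obtains C :: "'a::real_inner set" and r where "finite C" "\<And>c. bounded_linear (r c)"
    "\<And>v. v = (\<Sum>c\<in>C. r c v *\<^sub>R c)"
proof -
  obtain B :: "'a set" where "finite B" "span B = UNIV"
    using assms unfolding fin_dim_def by auto
  then obtain C where C: "finite C" "span C = (UNIV :: 'a set)" "pairwise orthogonal C"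
    using basis_orthogonal by metis
  \<comment> \<open>The set \<open>C\<close> may contain 0; division by zero then gives the zero
    functional, and that summand vanishes anyway.\<close>
  define r where "r = (\<lambda>c v. inner v c / inner c (c::'a))"
  have "v = (\<Sum>c\<in>C. r c v *\<^sub>R c)" for v
  proof -
    have "v \<in> span C" using C by simp
    then show ?thesis
    proof (induction rule: span_induct_alt)
      case base
      then show ?case by (simp add: r_def)
    next
      case (step a x y)
      have "r c (a *\<^sub>R x + y) *\<^sub>R c = (if c = x then a *\<^sub>R x else 0) + r c y *\<^sub>R c" if "c \<in> C" for c
      proof (cases "c = x")
        case False
        then have "inner x c = 0"
          using C(3) step(1) that by (auto simp: pairwise_def orthogonal_def)
        with False show ?thesis by (simp add: r_def inner_add_left)
      qed (auto simp: r_def inner_add_left add_divide_distrib scaleR_add_left)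
      then have "(\<Sum>c\<in>C. r c (a *\<^sub>R x + y) *\<^sub>R c) = a *\<^sub>R x + (\<Sum>c\<in>C. r c y *\<^sub>R c)"
        using C(1) step(1) by (simp add: sum.distrib)
      then show ?case using step(2) by simp
    qed
  qed
  moreover have "bounded_linear (r c)" for c
    unfolding r_def by (rule bounded_linear_compose[OF bounded_linear_divide bounded_linear_inner_left])
  ultimately show thesis using that C(1) by blast
qed

lemma fin_dim_bounded_linear:
  fixes f :: "'a::real_inner \<Rightarrow> 'b::real_normed_vector"
  assumes "fin_dim TYPE('a)" "linear f"
  shows "bounded_linear f"
proof -
  obtain C :: "'a set" and r where C: "finite C" "\<And>c. bounded_linear (r c)"
    "\<And>v. v = (\<Sum>c\<in>C. r c v *\<^sub>R c)"
    using fin_dim_coordinates[OF assms(1)] by metis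
  have "f v = (\<Sum>c\<in>C. r c v *\<^sub>R f c)" for v
    using arg_cong[OF C(3)[of v], of f] by (simp add: linear_sum[OF assms(2)] linear_cmul[OF assms(2)])
  then have "f = (\<lambda>v. \<Sum>c\<in>C. r c v *\<^sub>R f c)" by blast
  moreover have "bounded_linear (\<lambda>v. \<Sum>c\<in>C. r c v *\<^sub>R f c)"
    by (intro bounded_linear_sum bounded_linear_scaleR_const C)
  ultimately show ?thesis by metis
qed


section \<open>Calculus of smooth functions\<close>

abbreviation fderiv :: "('a::real_normed_vector \<Rightarrow> 'b::real_normed_vector) \<Rightarrow> 'a \<Rightarrow> 'a \<Rightarrow> 'b" where
  "fderiv f x \<equiv> frechet_derivative f (at x)"

lemma Ck_on_subset: "Ck_on k S f \<Longrightarrow> T \<subseteq> S \<Longrightarrow> Ck_on k T f"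
  by (induction k arbitrary: f) (auto intro: continuous_on_subset)

lemma fderiv_cong:
  assumes "open S" "x \<in> S" "\<And>y. y \<in> S \<Longrightarrow> f y = g y"
  shows "fderiv f x = fderiv g x"
proof -
  have "(f has_derivative f') (at x) \<longleftrightarrow> (g has_derivative f') (at x)" for f'
    using has_derivative_transform_within_open[OF _ assms(1,2), of f f' UNIV g]
      has_derivative_transform_within_open[OF _ assms(1,2), of g f' UNIV f] assms(3) by auto
  then show ?thesis by (simp add: frechet_derivative_def)
qed

lemma differentiable_cong_open:
  assumes "open S" "x \<in> S" "\<And>y. y \<in> S \<Longrightarrow> f y = g y"
  shows "f differentiable (at x) \<Longrightarrow> g differentiable (at x)"
  unfolding differentiable_def
  using has_derivative_transform_within_open[OF _ assms(1,2), of f _ UNIV g] assms(3) by auto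

lemma Ck_on_cong:
  assumes "open S" "Ck_on k S f" "\<And>y. y \<in> S \<Longrightarrow> f y = g y"
  shows "Ck_on k S g"
  using assms(2,3)
proof (induction k arbitrary: f g)
  case 0
  then show ?case using continuous_on_eq by auto
next
  case (Suc k)
  have "Ck_on k S (\<lambda>x. fderiv g x v)" for v
  proof (rule Suc.IH)
    show "Ck_on k S (\<lambda>x. fderiv f x v)" using Suc.prems(1) by simp
    show "fderiv f y v = fderiv g y v" if "y \<in> S" for y
      using fderiv_cong[OF assms(1) that, of f g] Suc.prems(2) by simp
  qed
  then show ?case
    using Suc.prems differentiable_cong_open[OF assms(1), of _ f g] by auto
qed

lemma Ck_on_SucD: "Ck_on (Suc k) S f \<Longrightarrow> Ck_on k S f"
proof (induction k arbitrary: f)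
  case 0
  then show ?case
    by (auto intro: continuous_at_imp_continuous_on differentiable_imp_continuous_within)
qed auto

text \<open>Induction step for the closure properties below: an explicit derivative, known on the
  open set \<open>S\<close> only, replaces \<open>frechet_derivative\<close>, which is given by
  choice.\<close>

lemma Ck_on_Suc_I:
  assumes "open S" "\<And>x. x \<in> S \<Longrightarrow> (f has_derivative f' x) (at x)" "\<And>v. Ck_on k S (\<lambda>x. f' x v)"
  shows "Ck_on (Suc k) S f"
proof -
  have "Ck_on k S (\<lambda>x. fderiv f x v)" for v
    using frechet_derivative_at[OF assms(2)]
    by (intro Ck_on_cong[OF assms(1) assms(3)[of v]]) simp
  then show ?thesis using assms(2) by (auto simp: differentiable_def)
qed

lemma has_derivative_fderiv: "f differentiable (at x) \<Longrightarrow> (f has_derivative fderiv f x) (at x)"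
  by (simp add: frechet_derivative_works)

lemma Ck_on_has_derivative:
  "Ck_on (Suc k) S f \<Longrightarrow> x \<in> S \<Longrightarrow> (f has_derivative fderiv f x) (at x)"
  by (simp add: has_derivative_fderiv)

section \<open>Closure properties of functions of class \<open>Ck_on\<close>\<close>

lemma Ck_on_const: "open S \<Longrightarrow> Ck_on k S (\<lambda>x. c)"
  by (induction k arbitrary: c) (auto intro!: Ck_on_Suc_I[where f' = "\<lambda>x v. 0"] simp del: Ck_on.simps(2))

lemma Ck_on_add:
  assumes "open S" "Ck_on k S f" "Ck_on k S g"
  shows "Ck_on k S (\<lambda>x. f x + g x)"
  using assms(2,3)
proof (induction k arbitrary: f g)
  case (Suc k)
  show ?case
    using Suc.prems
    by (intro Ck_on_Suc_I[OF assms(1), where f' = "\<lambda>x v. fderiv f x v + fderiv g x v"]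
        has_derivative_add has_derivative_fderiv Suc.IH) auto
qed (auto intro: continuous_on_add)

lemma Ck_on_sum:
  assumes "open S" "finite I" "\<And>i. i \<in> I \<Longrightarrow> Ck_on k S (f i)"
  shows "Ck_on k S (\<lambda>x. \<Sum>i\<in>I. f i x)"
  using assms(2,3) by (induction rule: finite_induct) (auto intro: Ck_on_const Ck_on_add assms(1))

lemma Ck_on_bounded_linear:
  assumes "open S" "bounded_linear T" "Ck_on k S f"
  shows "Ck_on k S (\<lambda>x. T (f x))"
  using assms(3)
proof (induction k arbitrary: f)
  case 0
  then show ?case using linear_continuous_on_compose assms(2) bounded_linear.continuous_on by auto
next
  case (Suc k)
  show ?case
    using Suc.prems
    by (intro Ck_on_Suc_I[OF assms(1), where f' = "\<lambda>x v. T (fderiv f x v)"]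
        bounded_linear.has_derivative[OF assms(2)] Ck_on_has_derivative[of k S] Suc.IH) auto
qed

lemma Ck_on_scaleR:
  assumes "open S" "Ck_on k S f" "Ck_on k S g"
  shows "Ck_on k S (\<lambda>x. f x *\<^sub>R g x)"
  using assms(2,3)
proof (induction k arbitrary: f g)
  case (Suc k)
  have "Ck_on k S f" "Ck_on k S g" using Suc.prems Ck_on_SucD by blast+
  moreover have "Ck_on k S (\<lambda>x. fderiv f x v)" "Ck_on k S (\<lambda>x. fderiv g x v)" for v
    using Suc.prems by auto
  ultimately have "Ck_on k S (\<lambda>x. f x *\<^sub>R fderiv g x v + fderiv f x v *\<^sub>R g x)" for v
    using assms(1) by (intro Ck_on_add Suc.IH)
  moreover have "((\<lambda>x. f x *\<^sub>R g x) has_derivative (\<lambda>v. f x *\<^sub>R fderiv g x v + fderiv f x v *\<^sub>R g x)) (at x)"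
    if "x \<in> S" for x
    using Suc.prems that by (intro has_derivative_scaleR Ck_on_has_derivative[of k S])
  ultimately show ?case by (intro Ck_on_Suc_I[OF assms(1)])
qed (auto intro: continuous_on_scaleR)

text \<open>By the chain rule, \<open>g\<close> is differentiated in a direction that varies with
  the point, whereas \<open>Ck_on\<close> controls derivatives in constant directions only.
  Expanding the direction in finitely many coordinates gives a sum of products of functions of class
  \<open>Ck_on k\<close>. The induction keeps \<open>f\<close> fixed and varies \<open>g\<close>,
  because the derivatives of \<open>g\<close> are again composed with \<open>f\<close>.\<close>

lemma Ck_on_compose:
  fixes f :: "'a::real_normed_vector \<Rightarrow> 'b::real_inner" and g :: "'b \<Rightarrow> 'c::real_normed_vector"
  assumes "fin_dim TYPE('b)" "open S" "f ` S \<subseteq> T" "Ck_on k S f" "Ck_on k T g"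
  shows "Ck_on k S (\<lambda>x. g (f x))"
  using assms(4,5)
proof (induction k arbitrary: g)
  case 0
  then show ?case using assms(3) by (auto intro: continuous_on_compose2)
next
  case (Suc k)
  obtain C :: "'b set" and r where C: "finite C" "\<And>c. bounded_linear (r c)"
    "\<And>v. v = (\<Sum>c\<in>C. r c v *\<^sub>R c)"
    using fin_dim_coordinates[OF assms(1)] by metis
  have "((\<lambda>x. g (f x)) has_derivative (\<lambda>v. \<Sum>c\<in>C. r c (fderiv f x v) *\<^sub>R fderiv g (f x) c)) (at x)"
    if x: "x \<in> S" for x
  proof -
    have fx: "f x \<in> T" using x assms(3) by auto
    have g: "(g has_derivative fderiv g (f x)) (at (f x))"
      using Ck_on_has_derivative[OF Suc.prems(2) fx] .
    have "(\<lambda>v. fderiv g (f x) (fderiv f x v)) = (\<lambda>v. \<Sum>c\<in>C. r c (fderiv f x v) *\<^sub>R fderiv g (f x) c)"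
    proof
      fix v
      let ?w = "fderiv f x v"
      have l: "linear (fderiv g (f x))" using g has_derivative_linear by blast
      show "fderiv g (f x) ?w = (\<Sum>c\<in>C. r c ?w *\<^sub>R fderiv g (f x) c)"
        using arg_cong[OF C(3)[of ?w], of "fderiv g (f x)"] by (simp add: linear_sum[OF l] linear_cmul[OF l])
    qed
    moreover have "((\<lambda>x. g (f x)) has_derivative (\<lambda>v. fderiv g (f x) (fderiv f x v))) (at x)"
      using has_derivative_compose[OF Ck_on_has_derivative[OF Suc.prems(1) x] g] .
    ultimately show ?thesis by simp
  qed
  moreover have "Ck_on k S (\<lambda>x. \<Sum>c\<in>C. r c (fderiv f x v) *\<^sub>R fderiv g (f x) c)" for v
    using Suc.prems Ck_on_SucD[OF Suc.prems(1)]
    by (intro Ck_on_sum Ck_on_scaleR Ck_on_bounded_linear[OF assms(2) C(2)] Suc.IH assms C(1)) auto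
  ultimately show ?case by (intro Ck_on_Suc_I[OF assms(2)])
qed

lemma smooth_on_empty: "smooth_on {} f"
proof -
  have "Ck_on k {} f" for k by (induction k arbitrary: f) auto
  then show ?thesis by (simp add: smooth_on_def)
qed

lemma smooth_on_subset: "smooth_on S f \<Longrightarrow> T \<subseteq> S \<Longrightarrow> smooth_on T f"
  unfolding smooth_on_def using Ck_on_subset by blast

lemma smooth_on_cong:
  "open S \<Longrightarrow> smooth_on S f \<Longrightarrow> (\<And>y. y \<in> S \<Longrightarrow> f y = g y) \<Longrightarrow> smooth_on S g"
  unfolding smooth_on_def using Ck_on_cong by blast

lemma smooth_on_compose:
  fixes f :: "'a::real_normed_vector \<Rightarrow> 'b::real_inner"
  shows "fin_dim TYPE('b) \<Longrightarrow> open S \<Longrightarrow> smooth_on S f \<Longrightarrow> smooth_on T g \<Longrightarrow> f ` S \<subseteq> T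
    \<Longrightarrow> smooth_on S (\<lambda>x. g (f x))"
  unfolding smooth_on_def using Ck_on_compose by blast

lemma smooth_on_differentiable: "smooth_on S f \<Longrightarrow> x \<in> S \<Longrightarrow> f differentiable (at x)"
  unfolding smooth_on_def using Ck_on.simps(2) by blast

lemma smooth_on_fderiv: "smooth_on S f \<Longrightarrow> smooth_on S (\<lambda>x. fderiv f x v)"
  unfolding smooth_on_def using Ck_on.simps(2) by blast

lemma smooth_on_bounded_linear:
  assumes "bounded_linear T"
  shows "smooth_on UNIV T"
  unfolding smooth_on_def
proof
  fix k
  show "Ck_on k UNIV T"
  proof (cases k)
    case 0
    then show ?thesis using assms linear_continuous_on by auto
  next
    case (Suc j)
    show ?thesis unfolding Suc
      by (intro Ck_on_Suc_I[where f' = "\<lambda>x. T"] Ck_on_const bounded_linear_imp_has_derivative assms) auto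
  qed
qed

lemma smooth_on_Pair:
  assumes "open S" "smooth_on S f" "smooth_on S g"
  shows "smooth_on S (\<lambda>x. (f x, g x))"
  unfolding smooth_on_def
proof
  fix k
  have "Ck_on k S (\<lambda>x. (f x, 0))"
    by (rule Ck_on_bounded_linear[where T = "\<lambda>y. (y, 0)"])
      (use assms in \<open>simp_all add: smooth_on_def bounded_linear_Pair bounded_linear_ident bounded_linear_zero\<close>)
  moreover have "Ck_on k S (\<lambda>x. (0, g x))"
    by (rule Ck_on_bounded_linear[where T = "\<lambda>y. (0, y)"])
      (use assms in \<open>simp_all add: smooth_on_def bounded_linear_Pair bounded_linear_ident bounded_linear_zero\<close>)
  ultimately have "Ck_on k S (\<lambda>x. (f x, 0) + (0, g x))"
    by (rule Ck_on_add[OF assms(1)])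
  then show "Ck_on k S (\<lambda>x. (f x, g x))" by simp
qed

text \<open>Smoothness of a germ. Hiding the neighbourhood in the existential quantifier spares the
  compositions of coordinate maps below any bookkeeping of domains.\<close>

definition smooth_at :: "('a::real_normed_vector \<Rightarrow> 'b::real_normed_vector) \<Rightarrow> 'a \<Rightarrow> bool" where
  "smooth_at f x \<longleftrightarrow> (\<exists>S. open S \<and> x \<in> S \<and> smooth_on S f)"

lemma smooth_atI: "smooth_on S f \<Longrightarrow> open S \<Longrightarrow> x \<in> S \<Longrightarrow> smooth_at f x"
  unfolding smooth_at_def by blast

lemma smooth_at_bounded_linear: "bounded_linear T \<Longrightarrow> smooth_at T x"
  by (rule smooth_atI[OF smooth_on_bounded_linear]) auto

lemma smooth_at_const: "smooth_at (\<lambda>x. c) x"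
  by (rule smooth_atI[of UNIV]) (auto simp: smooth_on_def Ck_on_const)

lemma smooth_at_id: "smooth_at (\<lambda>x. x) x"
  by (rule smooth_at_bounded_linear[OF bounded_linear_ident])

lemma smooth_at_has_derivative: "smooth_at f x \<Longrightarrow> (f has_derivative fderiv f x) (at x)"
  unfolding smooth_at_def using smooth_on_differentiable has_derivative_fderiv by blast

lemma smooth_at_linear: "smooth_at f x \<Longrightarrow> linear (fderiv f x)"
  using smooth_at_has_derivative has_derivative_linear by blast

lemma smooth_at_isCont: "smooth_at f x \<Longrightarrow> isCont f x"
  using smooth_at_has_derivative has_derivative_continuous by blast

lemma smooth_at_eventually: "smooth_at f x \<Longrightarrow> \<forall>\<^sub>F y in nhds x. smooth_at f y"
  unfolding smooth_at_def eventually_nhds by blast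

lemma smooth_at_cong:
  assumes "smooth_at f x" "\<forall>\<^sub>F y in nhds x. f y = g y"
  shows "smooth_at g x"
proof -
  obtain S T where "open S" "x \<in> S" "smooth_on S f" "open T" "x \<in> T" "\<And>y. y \<in> T \<Longrightarrow> f y = g y"
    using assms unfolding smooth_at_def eventually_nhds by metis
  then show ?thesis
    by (intro smooth_atI[of "S \<inter> T"] smooth_on_cong[of "S \<inter> T" f g]) (auto intro: smooth_on_subset)
qed

lemma fderiv_eventually_cong:
  assumes "\<forall>\<^sub>F y in nhds x. f y = g y"
  shows "fderiv f x = fderiv g x"
  using assms fderiv_cong unfolding eventually_nhds by metis

lemma smooth_at_Pair:
  assumes "smooth_at f x" "smooth_at g x"
  shows "smooth_at (\<lambda>x. (f x, g x)) x"
proof -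
  obtain S T where "open S" "x \<in> S" "smooth_on S f" "open T" "x \<in> T" "smooth_on T g"
    using assms unfolding smooth_at_def by metis
  then show ?thesis
    by (intro smooth_atI[of "S \<inter> T"] smooth_on_Pair) (auto intro: smooth_on_subset)
qed

lemma smooth_at_compose:
  fixes f :: "'a::real_normed_vector \<Rightarrow> 'b::real_inner"
  assumes "fin_dim TYPE('b)" "smooth_at g (f x)" "smooth_at f x"
  shows "smooth_at (\<lambda>x. g (f x)) x"
proof -
  obtain S T where ST: "open S" "x \<in> S" "smooth_on S f" "open T" "f x \<in> T" "smooth_on T g"
    using assms unfolding smooth_at_def by metis
  then have "continuous_on S f" unfolding smooth_on_def using Ck_on.simps(1) by blast
  then have "open (S \<inter> f -` T)" using ST by (simp add: continuous_open_preimage)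
  moreover have "smooth_on (S \<inter> f -` T) f" using ST(3) by (rule smooth_on_subset) auto
  ultimately have "smooth_on (S \<inter> f -` T) (\<lambda>x. g (f x))"
    by (rule smooth_on_compose[OF assms(1) _ _ ST(6)]) auto
  with \<open>open (S \<inter> f -` T)\<close> show ?thesis using ST by (auto intro: smooth_atI)
qed

lemma smooth_at_fderiv: "smooth_at f x \<Longrightarrow> smooth_at (\<lambda>y. fderiv f y v) x"
  unfolding smooth_at_def using smooth_on_fderiv by blast

lemma fderiv_compose:
  assumes "smooth_at g (f x)" "smooth_at f x"
  shows "fderiv (\<lambda>x. g (f x)) x v = fderiv g (f x) (fderiv f x v)"
proof -
  have "((\<lambda>x. g (f x)) has_derivative (\<lambda>v. fderiv g (f x) (fderiv f x v))) (at x)"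
    by (rule has_derivative_compose[OF assms(2)[THEN smooth_at_has_derivative] assms(1)[THEN smooth_at_has_derivative]])
  from frechet_derivative_at[OF this] show ?thesis by (metis (no_types))
qed

lemma isCont_eventually:
  assumes "isCont f x" "\<forall>\<^sub>F y in nhds (f x). P y"
  shows "\<forall>\<^sub>F x in nhds x. P (f x)"
  using eventually_compose_filterlim[OF assms(2), of f "nhds x"] assms(1)
  by (simp add: isCont_def tendsto_at_iff_tendsto_nhds)

section \<open>Symmetry of second derivatives\<close>

lemma smooth_at_has_real_derivative_line:
  fixes f :: "'a::real_normed_vector \<Rightarrow> real"
  assumes "smooth_at f (x + s *\<^sub>R v)"
  shows "((\<lambda>s. f (x + s *\<^sub>R v)) has_real_derivative fderiv f (x + s *\<^sub>R v) v) (at s)"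
proof -
  have "((\<lambda>s. x + s *\<^sub>R v) has_derivative (\<lambda>r. r *\<^sub>R v)) (at s)"
    by (auto intro!: derivative_eq_intros)
  from has_derivative_compose[OF this smooth_at_has_derivative[OF assms]]
  have "((\<lambda>s. f (x + s *\<^sub>R v)) has_derivative (\<lambda>r. fderiv f (x + s *\<^sub>R v) (r *\<^sub>R v))) (at s)" .
  moreover have "(\<lambda>r. fderiv f (x + s *\<^sub>R v) (r *\<^sub>R v)) = (*) (fderiv f (x + s *\<^sub>R v) v)"
    using linear_cmul[OF smooth_at_linear[OF assms]] by auto
  ultimately show ?thesis unfolding has_field_derivative_def by metis
qed

text \<open>The mean value theorem along \<open>v\<close> and then along \<open>w\<close> turns the
  quotient into a mixed second derivative at an intermediate point, and continuity of that
  derivative gives the limit. The quotient is symmetric in \<open>v\<close> and \<open>w\<close>,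
  which yields the symmetry of second derivatives.\<close>

lemma second_difference_tendsto:
  fixes f :: "'a::real_normed_vector \<Rightarrow> real"
  assumes "smooth_at f x"
  shows "((\<lambda>h. (f (x + h *\<^sub>R v + h *\<^sub>R w) - f (x + h *\<^sub>R v) - f (x + h *\<^sub>R w) + f x) / h\<^sup>2)
    \<longlongrightarrow> fderiv (\<lambda>y. fderiv f y v) x w) (at_right 0)"
proof (rule tendstoI)
  fix e :: real assume e: "e > 0"
  let ?g = "\<lambda>y. fderiv f y v" let ?k = "\<lambda>y. fderiv ?g y w"
  have "smooth_at ?k x" using assms by (intro smooth_at_fderiv)
  then have "isCont ?k x" by (rule smooth_at_isCont)
  then have "\<forall>\<^sub>F y in nhds x. dist (?k y) (?k x) < e"
    by (rule isCont_eventually) (use e in \<open>auto simp: eventually_nhds_metric\<close>)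
  then have "\<forall>\<^sub>F y in nhds x. dist (?k y) (?k x) < e \<and> smooth_at f y \<and> smooth_at ?g y"
    using smooth_at_eventually[OF assms] smooth_at_eventually[OF smooth_at_fderiv[OF assms]]
    by eventually_elim auto
  then obtain d where d: "d > 0"
    "\<And>y. dist y x < d \<Longrightarrow> dist (?k y) (?k x) < e \<and> smooth_at f y \<and> smooth_at ?g y"
    unfolding eventually_nhds_metric by blast
  \<comment> \<open>For \<open>h < d / n\<close> the parallelogram spanned by
    \<open>h *\<^sub>R v\<close> and \<open>h *\<^sub>R w\<close> at \<open>x\<close> lies in the
    ball of radius \<open>d\<close>; the summand 1 keeps \<open>n\<close> positive when both vectors
    vanish.\<close>
  define n where "n = norm v + norm w + 1"
  have n: "n > 0" unfolding n_def by (simp add: add_nonneg_pos)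
  have near: "dist (x + s *\<^sub>R v + t *\<^sub>R w) x < d" if "0 \<le> s" "0 \<le> t" "s \<le> h" "t \<le> h" "h < d / n" for s t h
  proof -
    have "norm (s *\<^sub>R v + t *\<^sub>R w) \<le> s * norm v + t * norm w"
      using norm_triangle_ineq[of "s *\<^sub>R v" "t *\<^sub>R w"] that by simp
    also have "\<dots> \<le> h * norm v + h * norm w"
      using that by (intro add_mono mult_right_mono) auto
    also have "\<dots> \<le> h * n" unfolding n_def using that by (simp add: algebra_simps)
    also have "\<dots> < d" using that n by (simp add: pos_less_divide_eq)
    finally show ?thesis by (simp add: dist_norm add.assoc)
  qed
  have "dist ((f (x + h *\<^sub>R v + h *\<^sub>R w) - f (x + h *\<^sub>R v) - f (x + h *\<^sub>R w) + f x) / h\<^sup>2) (?k x) < e"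
    if h: "0 < h" "h < d / n" for h
  proof -
    have f1: "((\<lambda>s. f (x + s *\<^sub>R v + t *\<^sub>R w)) has_real_derivative ?g (x + s *\<^sub>R v + t *\<^sub>R w)) (at s)"
      if "0 \<le> s" "s \<le> h" "0 \<le> t" "t \<le> h" for s t
    proof -
      have sm: "smooth_at f (x + s *\<^sub>R v + t *\<^sub>R w)" using near that h d by blast
      show ?thesis
        using smooth_at_has_real_derivative_line[of f "x + t *\<^sub>R w" s v] sm by (simp add: ac_simps)
    qed
    have f2: "((\<lambda>t. ?g (x + s *\<^sub>R v + t *\<^sub>R w)) has_real_derivative ?k (x + s *\<^sub>R v + t *\<^sub>R w)) (at t)"
      if "0 \<le> s" "s \<le> h" "0 \<le> t" "t \<le> h" for s t
    proof -
      have sm: "smooth_at ?g (x + s *\<^sub>R v + t *\<^sub>R w)" using near that h d by blast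
      show ?thesis
        using smooth_at_has_real_derivative_line[of ?g "x + s *\<^sub>R v" t w] sm by simp
    qed
    \<comment> \<open>The second difference is the increment over [0, h] of the single-variable
      function s |-> f (x + s v + h w) - f (x + s v).\<close>
    have "\<exists>s. 0 < s \<and> s < h \<and>
      (f (x + h *\<^sub>R v + h *\<^sub>R w) - f (x + h *\<^sub>R v + 0 *\<^sub>R w)) - (f (x + 0 *\<^sub>R v + h *\<^sub>R w) - f (x + 0 *\<^sub>R v + 0 *\<^sub>R w))
      = (h - 0) * (?g (x + s *\<^sub>R v + h *\<^sub>R w) - ?g (x + s *\<^sub>R v + 0 *\<^sub>R w))"
    proof (rule MVT2)
      fix s assume "0 \<le> s" "s \<le> h"
      then show "((\<lambda>s. f (x + s *\<^sub>R v + h *\<^sub>R w) - f (x + s *\<^sub>R v + 0 *\<^sub>R w)) has_real_derivative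
          ?g (x + s *\<^sub>R v + h *\<^sub>R w) - ?g (x + s *\<^sub>R v + 0 *\<^sub>R w)) (at s)"
        using f1[of s h] f1[of s 0] h by (intro DERIV_diff) auto
    qed (use h in simp)
    then obtain s where s: "0 < s" "s < h"
      "f (x + h *\<^sub>R v + h *\<^sub>R w) - f (x + h *\<^sub>R v) - f (x + h *\<^sub>R w) + f x
      = h * (?g (x + s *\<^sub>R v + h *\<^sub>R w) - ?g (x + s *\<^sub>R v + 0 *\<^sub>R w))" by (auto simp: algebra_simps)
    have "\<exists>t. 0 < t \<and> t < h \<and>
      ?g (x + s *\<^sub>R v + h *\<^sub>R w) - ?g (x + s *\<^sub>R v + 0 *\<^sub>R w) = (h - 0) * ?k (x + s *\<^sub>R v + t *\<^sub>R w)"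
    proof (rule MVT2)
      show "((\<lambda>t. ?g (x + s *\<^sub>R v + t *\<^sub>R w)) has_real_derivative ?k (x + s *\<^sub>R v + t *\<^sub>R w)) (at t)"
        if "0 \<le> t" "t \<le> h" for t
        using f2[of s t] s that by simp
    qed (use h in simp)
    then obtain t where t: "0 < t" "t < h"
      "?g (x + s *\<^sub>R v + h *\<^sub>R w) - ?g (x + s *\<^sub>R v + 0 *\<^sub>R w) = h * ?k (x + s *\<^sub>R v + t *\<^sub>R w)" by auto
    have "(f (x + h *\<^sub>R v + h *\<^sub>R w) - f (x + h *\<^sub>R v) - f (x + h *\<^sub>R w) + f x) / h\<^sup>2
      = ?k (x + s *\<^sub>R v + t *\<^sub>R w)"
      unfolding s(3) t(3) using h by (simp add: power2_eq_square)
    with d(2)[OF near[of s t h]] s t h show ?thesis by simp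
  qed
  then show "\<forall>\<^sub>F h in at_right 0. dist ((f (x + h *\<^sub>R v + h *\<^sub>R w) - f (x + h *\<^sub>R v)
    - f (x + h *\<^sub>R w) + f x) / h\<^sup>2) (?k x) < e"
    unfolding eventually_at_right_field using d(1) n by (intro exI[of _ "d / n"]) auto
qed

lemma fderiv_fderiv_commute:
  fixes f :: "'a::real_normed_vector \<Rightarrow> real"
  assumes "smooth_at f x"
  shows "fderiv (\<lambda>y. fderiv f y v) x w = fderiv (\<lambda>y. fderiv f y w) x v"
proof (rule tendsto_unique)
  show "((\<lambda>h. (f (x + h *\<^sub>R v + h *\<^sub>R w) - f (x + h *\<^sub>R v) - f (x + h *\<^sub>R w) + f x) / h\<^sup>2)
    \<longlongrightarrow> fderiv (\<lambda>y. fderiv f y w) x v) (at_right 0)"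
    using second_difference_tendsto[OF assms, of w v] by (simp add: algebra_simps)
qed (use second_difference_tendsto[OF assms] in auto)


section \<open>Charts and tangent vectors\<close>

locale pointed_chart = smooth_manifold M for M :: "('m, 'e::real_inner) manifold" +
  fixes U :: "'m set" and \<phi> :: "'m \<Rightarrow> 'e" and p :: 'm
  assumes chart: "(U, \<phi>) \<in> charts M" and p_in_U: "p \<in> U"
begin

abbreviation \<phi>i :: "'e \<Rightarrow> 'm" where "\<phi>i \<equiv> inv_into U \<phi>"

section \<open>A chart and its inverse as continuous maps between open sets\<close>

lemma model_fin_dim: "fin_dim TYPE('e)"
  using finite_dim by (simp add: fin_dim_def)

lemma openin_U: "openin (mtop M) U" and open_image_U: "open (\<phi> ` U)"
  using chart_open[OF chart] by auto

lemma U_subset: "U \<subseteq> topspace (mtop M)"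
  using openin_U openin_subset by blast

lemma topspace_U: "topspace (subtopology (mtop M) U) = U"
  using U_subset by auto

lemma inj_on_\<phi>: "inj_on \<phi> U"
  using homeomorphic_imp_injective_map[OF chart_homeo[OF chart]] topspace_U by simp

lemma \<phi>i_\<phi>: "q \<in> U \<Longrightarrow> \<phi>i (\<phi> q) = q"
  using inj_on_\<phi> by simp

lemma \<phi>_\<phi>i: "u \<in> \<phi> ` U \<Longrightarrow> \<phi> (\<phi>i u) = u"
  by (rule f_inv_into_f)

lemma \<phi>i_in_U: "u \<in> \<phi> ` U \<Longrightarrow> \<phi>i u \<in> U"
  by (rule inv_into_into)

lemma continuous_map_\<phi>: "continuous_map (subtopology (mtop M) U) euclidean \<phi>"
  using homeomorphic_imp_continuous_map[OF chart_homeo[OF chart]] continuous_map_in_subtopology by blast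

lemma continuous_map_\<phi>i: "continuous_map (top_of_set (\<phi> ` U)) (mtop M) \<phi>i"
proof -
  obtain g where g: "homeomorphic_maps (subtopology (mtop M) U) (top_of_set (\<phi> ` U)) \<phi> g"
    using chart_homeo[OF chart] homeomorphic_map_maps by blast
  then have "continuous_map (top_of_set (\<phi> ` U)) (mtop M) g"
    using homeomorphic_maps_def continuous_map_in_subtopology by metis
  moreover have "g u = \<phi>i u" if "u \<in> \<phi> ` U" for u
    using that g \<phi>i_\<phi> topspace_U unfolding homeomorphic_maps_def by auto
  ultimately show ?thesis by (rule continuous_map_eq) auto
qed

lemma open_chart_preimage: "openin (mtop M) W \<Longrightarrow> open {u \<in> \<phi> ` U. \<phi>i u \<in> W}"
  using openin_continuous_map_preimage[OF continuous_map_\<phi>i] openin_open_eq[OF open_image_U] by simp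

lemma open_chart_image: "openin (mtop M) W \<Longrightarrow> open (\<phi> ` (U \<inter> W))"
proof -
  have "\<phi> ` (U \<inter> W) = {u \<in> \<phi> ` U. \<phi>i u \<in> W}" by (auto simp: \<phi>i_\<phi>)
  then show "openin (mtop M) W \<Longrightarrow> open (\<phi> ` (U \<inter> W))" using open_chart_preimage by simp
qed

lemma openin_chart_preimage: "open T \<Longrightarrow> openin (mtop M) {q \<in> U. \<phi> q \<in> T}"
  using openin_continuous_map_preimage[OF continuous_map_\<phi>, of T] openin_open_subtopology[OF openin_U]
  unfolding topspace_U by simp

lemma eventually_chart:
  assumes "openin (mtop M) W" "u \<in> \<phi> ` U" "\<phi>i u \<in> W"
  shows "\<forall>\<^sub>F v in nhds u. v \<in> \<phi> ` U \<and> \<phi>i v \<in> W"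
  using open_chart_preimage[OF assms(1)] assms(2,3) unfolding eventually_nhds
  by (intro exI[of _ "{u \<in> \<phi> ` U. \<phi>i u \<in> W}"]) auto

lemma eventually_in_chart: "\<forall>\<^sub>F v in nhds (\<phi> p). v \<in> \<phi> ` U"
  using open_image_U p_in_U by (auto intro: eventually_nhds_in_open)

end

lemma inv_into_UNIV_ident: "inv_into UNIV (\<lambda>x. x) = (\<lambda>x. x)"
  using inv_id unfolding id_def .

lemma smooth_map_on_euclid_target:
  fixes M :: "('m, 'd::real_inner) manifold" and f :: "'m \<Rightarrow> 'e::real_inner"
  shows "smooth_map_on W M euclid f \<longleftrightarrow> openin (mtop M) W \<and>
    continuous_map (subtopology (mtop M) W) euclidean f \<and>
    (\<forall>(U, \<phi>)\<in>charts M. smooth_on (\<phi> ` (U \<inter> W)) (\<lambda>u. f (inv_into U \<phi> u)))"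
  by (simp add: smooth_map_on_def euclid_def o_def Int_def)

lemma smooth_map_on_euclid_source:
  fixes M :: "('m, 'd::real_inner) manifold" and c :: "'e::real_inner \<Rightarrow> 'm"
  shows "smooth_map_on W euclid M c \<longleftrightarrow> open W \<and>
    continuous_map (top_of_set W) (mtop M) c \<and>
    (\<forall>(V, \<psi>)\<in>charts M. smooth_on {t \<in> W. c t \<in> V} (\<lambda>t. \<psi> (c t)))"
  by (simp add: smooth_map_on_def euclid_def o_def inv_into_UNIV_ident)

context pointed_chart
begin

text \<open>One chart decides: in any other chart, \<open>f\<close> is its expression in the given
  chart composed with a transition map, which is smooth by \<open>charts_compatible\<close>.\<close>

lemma smooth_near_iff: "smooth_near M p f \<longleftrightarrow> smooth_at (\<lambda>u. f (\<phi>i u)) (\<phi> p)"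
proof
  assume "smooth_near M p f"
  then obtain W where W: "p \<in> W" "smooth_map_on W M euclid f" unfolding smooth_near_def by blast
  then have "smooth_on (\<phi> ` (U \<inter> W)) (\<lambda>u. f (\<phi>i u))" "openin (mtop M) W"
    using chart unfolding smooth_map_on_euclid_target by auto
  then show "smooth_at (\<lambda>u. f (\<phi>i u)) (\<phi> p)"
    using W(1) p_in_U open_chart_image by (auto intro: smooth_atI)
next
  assume "smooth_at (\<lambda>u. f (\<phi>i u)) (\<phi> p)"
  then obtain T where T: "open T" "\<phi> p \<in> T" "smooth_on T (\<lambda>u. f (\<phi>i u))"
    unfolding smooth_at_def by blast
  define W where "W = {q \<in> U. \<phi> q \<in> T}"
  have WU: "W \<subseteq> U" unfolding W_def by auto
  have W: "openin (mtop M) W" unfolding W_def by (rule openin_chart_preimage[OF T(1)])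
  have "continuous_map (subtopology (mtop M) W) (top_of_set T) \<phi>"
    unfolding continuous_map_in_subtopology
    using continuous_map_from_subtopology_mono[OF continuous_map_\<phi> WU] by (auto simp: W_def)
  moreover have "continuous_map (top_of_set T) euclidean (\<lambda>u. f (\<phi>i u))"
    using T(3) unfolding smooth_on_def continuous_map_iff_continuous using Ck_on.simps(1) by blast
  ultimately have "continuous_map (subtopology (mtop M) W) euclidean ((\<lambda>u. f (\<phi>i u)) \<circ> \<phi>)"
    by (rule continuous_map_compose)
  then have cont: "continuous_map (subtopology (mtop M) W) euclidean f"
    by (rule continuous_map_eq) (auto simp: W_def \<phi>i_\<phi>)
  have "smooth_on (\<psi> ` (V \<inter> W)) (\<lambda>u. f (inv_into V \<psi> u))" if V: "(V, \<psi>) \<in> charts M" for V \<psi>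
  \<comment> \<open>The locale \<open>pointed_chart\<close> asks for a point of the domain, so an
    empty chart is treated separately.\<close>
  proof (cases "V = {}")
    case False
    then obtain v where "v \<in> V" by blast
    with V interpret V: pointed_chart M V \<psi> v by unfold_locales
    have op: "open (\<psi> ` (V \<inter> W))" by (rule V.open_chart_image[OF W])
    have inv: "inv_into V \<psi> u \<in> W" if "u \<in> \<psi> ` (V \<inter> W)" for u
      using that V.\<phi>i_\<phi> by auto
    have "smooth_on (\<psi> ` (V \<inter> W)) (\<lambda>u. \<phi> (inv_into V \<psi> u))"
      using smooth_on_subset[OF charts_compatible[OF V chart], of "\<psi> ` (V \<inter> W)"] WU
      by (auto simp: o_def)
    then have "smooth_on (\<psi> ` (V \<inter> W)) (\<lambda>u. f (\<phi>i (\<phi> (inv_into V \<psi> u))))"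
      using inv by (intro smooth_on_compose[OF model_fin_dim op _ T(3)]) (auto simp: W_def)
    moreover have "f (\<phi>i (\<phi> (inv_into V \<psi> u))) = f (inv_into V \<psi> u)" if "u \<in> \<psi> ` (V \<inter> W)" for u
      using inv[OF that] WU by (simp add: \<phi>i_\<phi> subsetD)
    ultimately show ?thesis by (rule smooth_on_cong[OF op])
  qed (simp add: smooth_on_empty)
  then have "smooth_map_on W M euclid f" unfolding smooth_map_on_euclid_target using W cont by auto
  moreover have "p \<in> W" using T(2) p_in_U by (simp add: W_def)
  ultimately show "smooth_near M p f" unfolding smooth_near_def by blast
qed

text \<open>The tangent vector with coordinates \<open>w\<close>. The value 0 on the other functions
  follows the convention of \<open>velocity\<close>, so that the two can be equal as
  functionals.\<close>

definition tvec :: "'e \<Rightarrow> 'm tvec" where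
  "tvec w = (\<lambda>f. if smooth_near M p f then fderiv (\<lambda>u. f (\<phi>i u)) (\<phi> p) w else 0)"

lemma tvec_eq: "smooth_near M p f \<Longrightarrow> tvec w f = fderiv (\<lambda>u. f (\<phi>i u)) (\<phi> p) w"
  by (simp add: tvec_def)

lemma tvec_linear: "tvec (a *\<^sub>R u + b *\<^sub>R v) = (\<lambda>f. a * tvec u f + b * tvec v f)"
proof
  fix f
  show "tvec (a *\<^sub>R u + b *\<^sub>R v) f = a * tvec u f + b * tvec v f"
  proof (cases "smooth_near M p f")
    case True
    then have "linear (fderiv (\<lambda>u. f (\<phi>i u)) (\<phi> p))" using smooth_near_iff smooth_at_linear by blast
    then show ?thesis using True by (simp add: tvec_def linear_add linear_cmul)
  qed (simp add: tvec_def)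
qed

lemma tvec_0: "tvec 0 = (\<lambda>f. 0)"
  using tvec_linear[of 0 0 0 0] by simp

lemma tvec_scaleR: "tvec (a *\<^sub>R u) = (\<lambda>f. a * tvec u f)"
  using tvec_linear[of a u 0 u] by simp

text \<open>The chain rule, with smoothness asked of the coordinate curve \<gamma> only. In this
  form it serves both for the curves that define tangent vectors and for the image of a line under
  \<BB>.\<close>

lemma deriv_curve:
  assumes "smooth_at \<gamma> (0::real)" "\<gamma> 0 = \<phi> p" "\<forall>\<^sub>F t in nhds 0. c t = \<phi>i (\<gamma> t)" "smooth_near M p f"
  shows "deriv (\<lambda>t. f (c t)) 0 = tvec (fderiv \<gamma> 0 1) f"
proof -
  have f: "smooth_at (\<lambda>u. f (\<phi>i u)) (\<gamma> 0)" using assms smooth_near_iff by simp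
  have ev: "\<forall>\<^sub>F t in nhds 0. f (\<phi>i (\<gamma> t)) = f (c t)" using assms(3) by eventually_elim simp
  have sm: "smooth_at (\<lambda>t. f (\<phi>i (\<gamma> t))) 0"
    by (rule smooth_at_compose[OF model_fin_dim f assms(1)])
  have "smooth_at (\<lambda>t. f (c t)) 0" by (rule smooth_at_cong[OF sm ev])
  then have "deriv (\<lambda>t. f (c t)) 0 = fderiv (\<lambda>t. f (c t)) 0 1"
    using smooth_at_has_real_derivative_line[of "\<lambda>t. f (c t)" 0 0 1] by (auto intro: DERIV_imp_deriv)
  also have "\<dots> = fderiv (\<lambda>t. f (\<phi>i (\<gamma> t))) 0 1" using fderiv_eventually_cong[OF ev] by simp
  also have "\<dots> = fderiv (\<lambda>u. f (\<phi>i u)) (\<gamma> 0) (fderiv \<gamma> 0 1)" by (rule fderiv_compose[OF f assms(1)])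
  finally show ?thesis using assms by (simp add: tvec_def)
qed

lemma velocity_eq_tvec:
  assumes "smooth_at \<gamma> (0::real)" "\<gamma> 0 = \<phi> p" "\<forall>\<^sub>F t in nhds 0. c t = \<phi>i (\<gamma> t)"
  shows "velocity M c = tvec (fderiv \<gamma> 0 1)"
proof
  fix f
  have "c 0 = p" using eventually_nhds_x_imp_x[OF assms(3)] assms(2) \<phi>i_\<phi> p_in_U by simp
  then show "velocity M c f = tvec (fderiv \<gamma> 0 1) f"
    using deriv_curve[OF assms] by (cases "smooth_near M p f") (simp_all add: velocity_def tvec_def)
qed

lemma tvec_in_tangent_space: "tvec w \<in> tangent_space M p"
proof -
  define \<gamma> where "\<gamma> = (\<lambda>t::real. \<phi> p + t *\<^sub>R w)"
  have bl: "bounded_linear (\<lambda>t::real. t *\<^sub>R w)" by (rule bounded_linear_scaleR_left)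
  have cont: "continuous_on UNIV \<gamma>" unfolding \<gamma>_def by (intro continuous_intros)
  have smooth: "smooth_on UNIV \<gamma>"
    using smooth_on_bounded_linear[OF bl] Ck_on_add[OF open_UNIV Ck_on_const[OF open_UNIV]]
    unfolding \<gamma>_def smooth_on_def by blast
  have "open (\<gamma> -` (\<phi> ` U))" using open_vimage[OF open_image_U cont] .
  moreover have "0 \<in> \<gamma> -` (\<phi> ` U)" using p_in_U by (simp add: \<gamma>_def)
  ultimately obtain e where e: "e > 0" "ball 0 e \<subseteq> \<gamma> -` (\<phi> ` U)"
    using open_contains_ball by blast
  define I where "I = {-e<..<e}"
  have I: "open I" "0 \<in> I" "I \<subseteq> \<gamma> -` (\<phi> ` U)"
    using e by (auto simp: I_def ball_eq_greaterThanLessThan)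
  define c where "c = (\<lambda>t. \<phi>i (\<gamma> t))"
  have cU: "c t \<in> U" and \<phi>c: "\<phi> (c t) = \<gamma> t" if "t \<in> I" for t
    using I(3) that by (auto simp: c_def \<phi>i_\<phi> subset_iff)
  have contc: "continuous_map (top_of_set I) (mtop M) c"
  proof -
    have "continuous_map (top_of_set I) (top_of_set (\<phi> ` U)) \<gamma>"
      using continuous_on_subset[OF cont, of I] I(3) by auto
    from continuous_map_compose[OF this continuous_map_\<phi>i] show ?thesis by (simp add: c_def o_def)
  qed
  have "smooth_on {t \<in> I. c t \<in> V} (\<lambda>t. \<psi> (c t))" if V: "(V, \<psi>) \<in> charts M" for V \<psi>
  proof -
    have "openin (mtop M) V" using chart_open[OF V] by blast
    then have "openin (top_of_set I) {t \<in> I. c t \<in> V}"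
      using openin_continuous_map_preimage[OF contc] by simp
    then have op: "open {t \<in> I. c t \<in> V}" using I(1) openin_open_eq by blast
    have "smooth_on (\<phi> ` (U \<inter> V)) (\<lambda>u. \<psi> (\<phi>i u))"
      using charts_compatible[OF chart V] by (simp add: o_def)
    moreover have "\<gamma> ` {t \<in> I. c t \<in> V} \<subseteq> \<phi> ` (U \<inter> V)"
    proof (rule image_subsetI)
      fix t assume "t \<in> {t \<in> I. c t \<in> V}"
      then show "\<gamma> t \<in> \<phi> ` (U \<inter> V)" using cU \<phi>c by (intro image_eqI[of _ _ "c t"]) auto
    qed
    ultimately have "smooth_on {t \<in> I. c t \<in> V} (\<lambda>t. \<psi> (\<phi>i (\<gamma> t)))"
      using smooth_on_compose[OF model_fin_dim op smooth_on_subset[OF smooth subset_UNIV]] by blast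
    then show ?thesis by (simp add: c_def)
  qed
  then have "smooth_map_on {-e<..<e} euclid M c"
    unfolding smooth_map_on_euclid_source using I(1) contc by (auto simp: I_def)
  moreover have "c 0 = p" using p_in_U by (simp add: c_def \<gamma>_def \<phi>i_\<phi>)
  ultimately have "velocity M c \<in> tangent_space M p"
    unfolding tangent_space_def using e(1) by blast
  moreover have "fderiv \<gamma> 0 1 = w"
  proof -
    have "(\<gamma> has_derivative (\<lambda>t. t *\<^sub>R w)) (at 0)"
      unfolding \<gamma>_def by (auto intro!: derivative_eq_intros)
    from frechet_derivative_at[OF this] show ?thesis by (metis scaleR_one)
  qed
  moreover have "velocity M c = tvec (fderiv \<gamma> 0 1)"
  proof (rule velocity_eq_tvec)
    show "smooth_at \<gamma> 0" using smooth by (rule smooth_atI) auto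
  qed (simp_all add: \<gamma>_def c_def)
  ultimately show ?thesis by simp
qed

lemma tangent_space_eq: "tangent_space M p = range tvec"
proof (intro equalityI subsetI)
  fix x assume "x \<in> tangent_space M p"
  then obtain c e where c: "x = velocity M c" "c 0 = p" "0 < (e::real)" "smooth_map_on {-e<..<e} euclid M c"
    unfolding tangent_space_def by auto
  define T where "T = {t \<in> {-e<..<e}. c t \<in> U}"
  have "openin (top_of_set {-e<..<e}) T" unfolding T_def
    using openin_continuous_map_preimage[OF _ openin_U, of "top_of_set {-e<..<e}" c] c(4)
    unfolding smooth_map_on_euclid_source by simp
  then have T: "open T" "0 \<in> T" using openin_open_eq[of "{-e<..<e}" T] c p_in_U by (auto simp: T_def)
  moreover have "smooth_on T (\<lambda>t. \<phi> (c t))"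
    using c(4) chart unfolding smooth_map_on_euclid_source T_def by blast
  ultimately have "smooth_at (\<lambda>t. \<phi> (c t)) 0" by (intro smooth_atI)
  moreover have "\<forall>\<^sub>F t in nhds 0. c t = \<phi>i (\<phi> (c t))"
    using eventually_nhds_in_open[OF T] by eventually_elim (simp add: T_def \<phi>i_\<phi>)
  ultimately have "velocity M c = tvec (fderiv (\<lambda>t. \<phi> (c t)) 0 1)"
    using c(2) by (intro velocity_eq_tvec) auto
  then show "x \<in> range tvec" using c(1) by auto
qed (use tvec_in_tangent_space in auto)

text \<open>The coordinate function in the direction \<open>w = u - v\<close> separates the two
  vectors: \<open>tvec z\<close> sends it to \<open>inner z w\<close>, so equality forces
  \<open>inner w w = 0\<close>.\<close>

lemma inj_tvec: "inj tvec"
proof (rule injI)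
  fix u v assume eq: "tvec u = tvec v"
  define w where "w = u - v"
  define f where "f = (\<lambda>q. inner (\<phi> q) w)"
  have "\<forall>\<^sub>F u in nhds (\<phi> p). inner u w = f (\<phi>i u)"
    using eventually_in_chart by eventually_elim (simp add: f_def \<phi>_\<phi>i)
  moreover have bl: "bounded_linear (\<lambda>u. inner u w)" by (rule bounded_linear_inner_left)
  ultimately have "smooth_at (\<lambda>u. f (\<phi>i u)) (\<phi> p)" "fderiv (\<lambda>u. f (\<phi>i u)) (\<phi> p) = fderiv (\<lambda>u. inner u w) (\<phi> p)"
    using smooth_at_cong[OF smooth_at_bounded_linear[OF bl]] fderiv_eventually_cong by metis+
  moreover have "fderiv (\<lambda>u. inner u w) (\<phi> p) = (\<lambda>u. inner u w)"
    using frechet_derivative_at[OF bounded_linear_imp_has_derivative[OF bl]] by simp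
  ultimately have "tvec z f = inner z w" for z
    by (simp add: tvec_def smooth_near_iff)
  then have "inner u w = inner v w" using eq by metis
  then have "inner w w = 0" by (simp add: w_def inner_diff_left)
  then show "u = v" by (simp add: w_def)
qed

text \<open>This makes the inverse of \<open>tvec\<close> one of the \<open>linear_charts\<close> of
  the tangent space, so that hypotheses on its linear manifold apply to coordinates taken from
  \<phi>.\<close>

lemma linear_iso_tvec: "linear_iso tvec (tangent_space M p)"
  unfolding linear_iso_def bij_betw_def using inj_tvec tangent_space_eq tvec_linear by blast

end


section \<open>Linear manifolds\<close>

text \<open>The argument of \<open>topology\<close> has to be shown to satisfy
  \<open>istopology\<close>. Intersections are the case with content: the charts are injective, so
  taking images commutes with intersecting.\<close>

lemma openin_linear_manifold:
  fixes V :: "('b \<Rightarrow> real) set"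
  shows "openin (mtop (linear_manifold V :: ('b \<Rightarrow> real, 'e::real_inner) manifold)) S \<longleftrightarrow>
    S \<subseteq> V \<and> (\<forall>L::'e \<Rightarrow> 'b \<Rightarrow> real. linear_iso L V \<longrightarrow> open (inv_into UNIV L ` S))"
proof -
  define P where "P = (\<lambda>S. S \<subseteq> V \<and> (\<forall>L::'e \<Rightarrow> 'b \<Rightarrow> real. linear_iso L V \<longrightarrow> open (inv_into UNIV L ` S)))"
  have "(\<lambda>S. S \<subseteq> V \<and> (\<forall>(U, \<phi>)\<in>(linear_charts V :: (_ \<times> (_ \<Rightarrow> 'e)) set). open (\<phi> ` S))) = P"
    unfolding linear_charts_def P_def by blast
  moreover have "istopology P"
    unfolding istopology_def
  proof (intro conjI allI impI)
    fix S T assume ST: "P S" "P T"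
    have "open (inv_into UNIV L ` (S \<inter> T))" if L: "linear_iso L V" for L :: "'e \<Rightarrow> 'b \<Rightarrow> real"
    proof -
      have "inj_on (inv_into UNIV L) V"
        using L unfolding linear_iso_def bij_betw_def by (metis inj_on_inv_into order_refl)
      then have "inv_into UNIV L ` (S \<inter> T) = inv_into UNIV L ` S \<inter> inv_into UNIV L ` T"
        using ST unfolding P_def by (intro inj_on_image_Int) auto
      then show ?thesis using ST L unfolding P_def by auto
    qed
    then show "P (S \<inter> T)" using ST unfolding P_def by blast
  next
    fix K assume "\<forall>S\<in>K. P S"
    then show "P (\<Union> K)" unfolding P_def by (auto simp: image_Union)
  qed
  ultimately show ?thesis
    unfolding linear_manifold_def by (simp add: topology_inverse') (simp add: P_def)
qed

lemma charts_linear_manifold: "charts (linear_manifold V) = linear_charts V"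
  by (simp add: linear_manifold_def)

lemma linear_iso_inv:
  assumes "linear_iso L V"
  shows "inv_into UNIV L (L u) = u" "x \<in> V \<Longrightarrow> L (inv_into UNIV L x) = x"
    "inv_into V (inv_into UNIV L) = L" "L u \<in> V" "L 0 = (\<lambda>s. 0)"
proof -
  have inj: "inj L" and V: "V = range L" using assms unfolding linear_iso_def bij_betw_def by auto
  show 1: "inv_into UNIV L (L u) = u" for u using inj by simp
  show "L (inv_into UNIV L x) = x" if "x \<in> V" using that V by (simp add: f_inv_into_f)
  have inj': "inj_on (inv_into UNIV L) V" unfolding V by (metis inj_on_inv_into order_refl)
  show "inv_into V (inv_into UNIV L) = L"
    using inv_into_f_f[OF inj', of "L _"] 1 V by auto
  show "L u \<in> V" using V by simp
  have "L (0 *\<^sub>R 0 + 0 *\<^sub>R 0) = (\<lambda>s. 0)"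
    using assms unfolding linear_iso_def by (metis add_0 mult_zero_left)
  then show "L 0 = (\<lambda>s. 0)" by simp
qed

context pointed_chart
begin

text \<open>The third claim guards against a default value: the differential of \<open>F\<close>
  applies a velocity to \<open>f \<circ> F\<close>, and a velocity is 0 on functions that are not
  smooth near the base point.\<close>

lemma smooth_at_from_linear_manifold:
  fixes L :: "'e \<Rightarrow> 'b \<Rightarrow> real"
  assumes F: "smooth_map_on V (linear_manifold V :: ('b \<Rightarrow> real, 'e) manifold) M F"
    and L: "linear_iso L V" and F0: "F (\<lambda>s. 0) = p"
  shows "smooth_at (\<lambda>u. \<phi> (F (L u))) 0" "\<forall>\<^sub>F u in nhds 0. F (L u) \<in> U"
    "smooth_near M p f \<Longrightarrow> smooth_near (linear_manifold V :: ('b \<Rightarrow> real, 'e) manifold) (\<lambda>s. 0) (f \<circ> F)"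
proof -
  let ?LM = "linear_manifold V :: ('b \<Rightarrow> real, 'e) manifold"
  have opV: "openin (mtop ?LM) V" and cont: "continuous_map (subtopology (mtop ?LM) V) (mtop M) F"
    using F unfolding smooth_map_on_def by auto
  have pre: "openin (mtop ?LM) {v \<in> V. F v \<in> W}" if "openin (mtop M) W" for W
    using openin_continuous_map_preimage[OF cont that] openin_open_subtopology[OF opV]
      openin_subset[OF opV] by (simp add: Int_absorb1)
  have smooth: "smooth_on (inv_into UNIV K ` {v \<in> V. F v \<in> W'}) (\<lambda>u. \<psi> (F (K u)))"
    if K: "linear_iso K V" and W': "(W', \<psi>) \<in> charts M" for K :: "'e \<Rightarrow> 'b \<Rightarrow> real" and W' \<psi>
  proof -
    have "(V, inv_into UNIV K) \<in> charts ?LM"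
      unfolding charts_linear_manifold linear_charts_def using K by blast
    with F W' have "smooth_on (inv_into UNIV K ` {v \<in> V \<inter> V. F v \<in> W'})
        (\<psi> \<circ> F \<circ> inv_into V (inv_into UNIV K))"
      unfolding smooth_map_on_def by blast
    then show ?thesis using linear_iso_inv(3)[OF K] by (simp add: o_def)
  qed
  have V0: "(\<lambda>s. 0) \<in> V" using linear_iso_inv(4,5)[OF L] by metis
  define S where "S = inv_into UNIV L ` {v \<in> V. F v \<in> U}"
  have S: "open S" using pre[OF openin_U] L unfolding openin_linear_manifold S_def by blast
  have "0 \<in> S" using V0 F0 p_in_U linear_iso_inv(1,5)[OF L] unfolding S_def
    by (metis (mono_tags, lifting) imageI mem_Collect_eq)
  then show "smooth_at (\<lambda>u. \<phi> (F (L u))) 0"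
    using smooth[OF L chart] S unfolding S_def by (intro smooth_atI)
  have "\<forall>\<^sub>F u in nhds 0. u \<in> S" using S \<open>0 \<in> S\<close> by (rule eventually_nhds_in_open)
  then show "\<forall>\<^sub>F u in nhds 0. F (L u) \<in> U"
    by eventually_elim (auto simp: S_def linear_iso_inv(2)[OF L])
  show "smooth_near ?LM (\<lambda>s. 0) (f \<circ> F)" if f: "smooth_near M p f"
  proof -
    obtain W where W: "p \<in> W" "smooth_map_on W M euclid f" using f unfolding smooth_near_def by blast
    then have opW: "openin (mtop M) W" and contW: "continuous_map (subtopology (mtop M) W) euclidean f"
      and sW: "smooth_on (\<phi> ` (U \<inter> W)) (\<lambda>u. f (\<phi>i u))"
      using chart unfolding smooth_map_on_euclid_target by auto
    \<comment> \<open>On this set \<open>F\<close> takes values both in the chart and where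
      \<open>f\<close> is smooth, so \<open>f \<circ> F\<close> factors through coordinates as (f
      \<circ> \<phi>i) \<circ> (\<phi> \<circ> F).\<close>
    define X where "X = {v \<in> V. F v \<in> U \<inter> W}"
    have opX: "openin (mtop ?LM) X" unfolding X_def by (intro pre openin_Int openin_U opW)
    have "continuous_map (subtopology (mtop ?LM) X) (subtopology (mtop M) W) F"
      unfolding continuous_map_in_subtopology
      using continuous_map_from_subtopology_mono[OF cont, of X] by (auto simp: X_def)
    from continuous_map_compose[OF this contW]
    have contX: "continuous_map (subtopology (mtop ?LM) X) euclidean (f \<circ> F)" .
    have "smooth_on (inv_into UNIV K ` X) (\<lambda>u. f (F (K u)))"
      if K: "linear_iso K V" for K :: "'e \<Rightarrow> 'b \<Rightarrow> real"
    proof -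
      have op: "open (inv_into UNIV K ` X)" using opX K unfolding openin_linear_manifold by blast
      have FK: "F (K u) \<in> U \<inter> W" if "u \<in> inv_into UNIV K ` X" for u
        using that linear_iso_inv(2)[OF K] by (auto simp: X_def)
      have "smooth_on (inv_into UNIV K ` X) (\<lambda>u. \<phi> (F (K u)))"
        by (rule smooth_on_subset[OF smooth[OF K chart]]) (auto simp: X_def)
      then have "smooth_on (inv_into UNIV K ` X) (\<lambda>u. f (\<phi>i (\<phi> (F (K u)))))"
        by (rule smooth_on_compose[OF model_fin_dim op _ sW]) (use FK in auto)
      then show ?thesis by (rule smooth_on_cong[OF op]) (use FK in \<open>auto simp: \<phi>i_\<phi>\<close>)
    qed
    moreover have "V \<inter> X = X" by (auto simp: X_def)
    ultimately have "smooth_map_on X ?LM euclid (f \<circ> F)"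
      unfolding smooth_map_on_euclid_target charts_linear_manifold
      using opX contX by (auto simp: linear_charts_def linear_iso_inv(3))
    moreover have "(\<lambda>s. 0) \<in> X" using V0 F0 W(1) p_in_U by (simp add: X_def)
    ultimately show ?thesis unfolding smooth_near_def by blast
  qed
qed

text \<open>By linearity the line through 0 with direction \<open>tvec w\<close> is t |->
  \<open>tvec (t *\<^sub>R w)\<close>, so its image under \<open>F\<close> has the coordinate curve
  t |-> \<beta> (t w), and \<open>deriv_curve\<close> applies.\<close>

lemma differential_linear_manifold:
  assumes F: "smooth_map_on (tangent_space M p)
      (linear_manifold (tangent_space M p) :: ('m tvec, 'e) manifold) M F"
    and F0: "F (\<lambda>f. 0) = p"
  shows "differential M F (\<lambda>f. 0) (velocity (linear_manifold (tangent_space M p) :: ('m tvec, 'e) manifold)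
      (\<lambda>t f. t * tvec w f)) = tvec (fderiv (\<lambda>u. \<phi> (F (tvec u))) 0 w)"
proof
  fix f
  let ?\<beta> = "\<lambda>u. \<phi> (F (tvec u))"
  note sm = smooth_at_from_linear_manifold[OF F linear_iso_tvec F0]
  show "differential M F (\<lambda>f. 0) (velocity (linear_manifold (tangent_space M p) :: ('m tvec, 'e) manifold)
      (\<lambda>t f. t * tvec w f)) f = tvec (fderiv ?\<beta> 0 w) f"
  proof (cases "smooth_near M p f")
    case True
    have bl: "bounded_linear (\<lambda>t::real. t *\<^sub>R w)" by (rule bounded_linear_scaleR_left)
    have sl: "smooth_at (\<lambda>t::real. t *\<^sub>R w) 0" by (rule smooth_at_bounded_linear[OF bl])
    have s\<beta>: "smooth_at ?\<beta> (0 *\<^sub>R w)" using sm(1) by simp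
    have s\<gamma>: "smooth_at (\<lambda>t. ?\<beta> (t *\<^sub>R w)) 0" by (rule smooth_at_compose[OF model_fin_dim s\<beta> sl])
    have "fderiv (\<lambda>t. t *\<^sub>R w) (0::real) 1 = w"
      using frechet_derivative_at[OF bounded_linear_imp_has_derivative[OF bl, of "at 0"]]
      by (metis scaleR_one)
    with fderiv_compose[OF s\<beta> sl] have "fderiv (\<lambda>t. ?\<beta> (t *\<^sub>R w)) 0 1 = fderiv ?\<beta> 0 w"
      by simp
    moreover have "\<forall>\<^sub>F t in nhds 0. F (tvec (t *\<^sub>R w)) = \<phi>i (?\<beta> (t *\<^sub>R w))"
    proof -
      have "\<forall>\<^sub>F t in nhds 0. F (tvec (t *\<^sub>R w)) \<in> U"
        by (rule isCont_eventually[OF smooth_at_isCont[OF sl]]) (use sm(2) in simp)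
      then show ?thesis by eventually_elim (simp add: \<phi>i_\<phi>)
    qed
    ultimately have "deriv (\<lambda>t. f (F (tvec (t *\<^sub>R w)))) 0 = tvec (fderiv ?\<beta> 0 w) f"
      using deriv_curve[OF s\<gamma> _ _ True] F0 by (simp add: tvec_0)
    then show ?thesis
      using True sm(3)[OF True] F0 by (simp add: differential_def velocity_def tvec_scaleR)
  qed (simp add: differential_def F0 tvec_def)
qed

end


section \<open>Partial derivatives\<close>

text \<open>Partial derivatives are rewritten as total derivatives in the directions
  \<open>(v, 0)\<close> and \<open>(0, w)\<close>, the form to which the symmetry of second
  derivatives applies.\<close>

lemma smooth_at_slices:
  fixes F :: "'a::real_inner \<times> 'b::real_inner \<Rightarrow> 'c::real_normed_vector"
  assumes fd: "fin_dim TYPE('a)" "fin_dim TYPE('b)" and F: "smooth_at F (a, b)"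
  shows "smooth_at (\<lambda>x. F (x, b)) a" "smooth_at (\<lambda>y. F (a, y)) b"
    "fderiv (\<lambda>x. F (x, b)) a v = fderiv F (a, b) (v, 0)"
    "fderiv (\<lambda>y. F (a, y)) b w = fderiv F (a, b) (0, w)"
proof -
  note fd2 = fin_dim_prod[OF fd]
  have s1: "smooth_at (\<lambda>x. (x, b)) a" and s2: "smooth_at (\<lambda>y. (a, y)) b"
    by (intro smooth_at_Pair smooth_at_id smooth_at_const)+
  have d1: "((\<lambda>x. (x, b)) has_derivative (\<lambda>v. (v, 0))) (at a)"
    and d2: "((\<lambda>y. (a, y)) has_derivative (\<lambda>v. (0, v))) (at b)"
    by (auto intro!: derivative_eq_intros)
  show "smooth_at (\<lambda>x. F (x, b)) a" by (rule smooth_at_compose[OF fd2 F s1])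
  show "smooth_at (\<lambda>y. F (a, y)) b" by (rule smooth_at_compose[OF fd2 F s2])
  show "fderiv (\<lambda>x. F (x, b)) a v = fderiv F (a, b) (v, 0)"
    using fderiv_compose[OF F s1, of v] frechet_derivative_at[OF d1] by metis
  show "fderiv (\<lambda>y. F (a, y)) b w = fderiv F (a, b) (0, w)"
    using fderiv_compose[OF F s2, of w] frechet_derivative_at[OF d2] by metis
qed

lemma smooth_at_diagonal:
  fixes F :: "'a::real_inner \<times> 'a \<Rightarrow> 'c::real_normed_vector"
  assumes fd: "fin_dim TYPE('a)" and F: "smooth_at F (a, a)"
  shows "fderiv (\<lambda>x. F (x, x)) a v = fderiv F (a, a) (v, 0) + fderiv F (a, a) (0, v)"
proof -
  have s: "smooth_at (\<lambda>x. (x, x)) a" by (intro smooth_at_Pair smooth_at_id)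
  have d: "((\<lambda>x. (x, x)) has_derivative (\<lambda>v. (v, v))) (at a)"
    by (auto intro!: derivative_eq_intros)
  have "fderiv (\<lambda>x. F (x, x)) a v = fderiv F (a, a) (v, v)"
    using fderiv_compose[OF F s, of v] frechet_derivative_at[OF d] by metis
  also have "(v, v) = (v, 0) + (0, v)" by simp
  finally show ?thesis using linear_add[OF smooth_at_linear[OF F]] by metis
qed

lemma eventually_nhds_slices:
  fixes a :: "'a::real_normed_vector" and b :: "'b::real_normed_vector"
  assumes "\<forall>\<^sub>F z in nhds (a, b). P z"
  shows "\<forall>\<^sub>F x in nhds a. P (x, b)" "\<forall>\<^sub>F y in nhds b. P (a, y)"
proof -
  have "isCont (\<lambda>x. (x, b)) a" "isCont (\<lambda>y. (a, y)) b" by simp_all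
  then show "\<forall>\<^sub>F x in nhds a. P (x, b)" "\<forall>\<^sub>F y in nhds b. P (a, y)"
    using isCont_eventually assms by blast+
qed

text \<open>This allows an identity near \<open>(a, b)\<close> to be differentiated in the second
  variable at \<open>b\<close>, for every first variable near \<open>a\<close>. It holds because a
  property true near a point is true near all points close to it.\<close>

lemma eventually_eventually_nhds_slice:
  fixes a :: "'a::real_normed_vector" and b :: "'b::real_normed_vector"
  assumes "\<forall>\<^sub>F z in nhds (a, b). P z"
  shows "\<forall>\<^sub>F x in nhds a. \<forall>\<^sub>F y in nhds b. P (x, y)"
proof -
  have "\<forall>\<^sub>F z in nhds (a, b). \<forall>\<^sub>F z' in nhds z. P z'" using assms by (simp add: eventually_eventually)
  from eventually_nhds_slices(1)[OF this] show ?thesis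
    by eventually_elim (rule eventually_nhds_slices(2))
qed

lemma fderiv_bounded_linear: "bounded_linear T \<Longrightarrow> fderiv T x = T"
  using frechet_derivative_at[OF bounded_linear_imp_has_derivative[of T "at x"]] by simp

text \<open>Here \<open>h\<close> is a function composed with the multiplication of a Lie group and \<open>\<kappa>\<close> is the
  conjugation \<open>(u, v) \<mapsto> u v u\<inverse>\<close>, both in coordinates; the first equation is
  \<open>(u v u\<inverse>) u = u v\<close>. The proof differentiates \<open>h (\<kappa> (u, v), w)\<close> in \<open>v\<close> and then along
  the diagonal \<open>u = w\<close>.\<close>

lemma commutator_derivative:
  fixes h :: "'e::real_inner \<times> 'e \<Rightarrow> real"
  assumes fd: "fin_dim TYPE('e)"
    and h: "smooth_at h (p, p)" and \<kappa>: "smooth_at \<kappa> (p, p)" and k: "smooth_at k p"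
    and conj: "\<forall>\<^sub>F z in nhds (p, p). h (\<kappa> z, fst z) = h z"
    and \<kappa>1: "\<forall>\<^sub>F v in nhds p. \<kappa> (p, v) = v" and \<kappa>2: "\<forall>\<^sub>F u in nhds p. \<kappa> (u, p) = p"
    and hk: "\<forall>\<^sub>F v in nhds p. h (v, p) = k v"
  shows "fderiv (\<lambda>z. fderiv h z (0, y)) (p, p) (x, 0) - fderiv (\<lambda>z. fderiv h z (0, x)) (p, p) (y, 0)
    = fderiv k p (fderiv (\<lambda>u. fderiv \<kappa> (u, p) (0, y)) p x)"
proof -
  note fd2 = fin_dim_prod[OF fd fd]
  note fd3 = fin_dim_prod[OF fd2 fd]
  note sl = smooth_at_slices[OF fd fd] and sl3 = smooth_at_slices[OF fd2 fd]
  note ev1 = eventually_nhds_slices(1)[where a = p and b = p] and ev2 = eventually_nhds_slices(2)[where a = p and b = p]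
  have \<kappa>p: "\<kappa> (p, p) = p" using eventually_nhds_x_imp_x[OF \<kappa>2] .
  \<comment> \<open>\<open>E ((u, w), v)\<close> is \<open>h (\<kappa> (u, v), w)\<close>: the two
    occurrences of u in (u v u^-1) u become independent variables u and w. Below,
    \<open>e (u, w)\<close> is its derivative in v at \<open>p\<close> in the direction
    \<open>y\<close>.\<close>
  define E where "E = (\<lambda>q. h (\<kappa> (fst (fst q), snd q), snd (fst q)))"
  define e where "e = (\<lambda>z. fderiv E (z, p) (0, y))"
  have bl: "bounded_linear (\<lambda>q::('e \<times> 'e) \<times> 'e. (fst (fst q), snd q))"
      "bounded_linear (\<lambda>q::('e \<times> 'e) \<times> 'e. snd (fst q))"
    by (intro bounded_linear_Pair bounded_linear_fst_comp bounded_linear_snd_comp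
        bounded_linear_fst bounded_linear_snd)+
  have "smooth_at (\<lambda>q. \<kappa> (fst (fst q), snd q)) ((p, p), p)"
    by (rule smooth_at_compose[OF fd2 _ smooth_at_bounded_linear[OF bl(1)]]) (simp add: \<kappa>)
  then have "smooth_at (\<lambda>q. (\<kappa> (fst (fst q), snd q), snd (fst q))) ((p, p), p)"
    by (rule smooth_at_Pair[OF _ smooth_at_bounded_linear[OF bl(2)]])
  then have E: "smooth_at E ((p, p), p)"
    unfolding E_def by (rule smooth_at_compose[OF fd2, rotated]) (simp add: h \<kappa>p)
  have e: "smooth_at e (p, p)"
    unfolding e_def by (rule sl3(1)) (rule smooth_at_fderiv[OF E])
  have E_ev: "\<forall>\<^sub>F z in nhds (p, p). smooth_at E (z, p)"
    by (rule eventually_nhds_slices(1)[OF smooth_at_eventually[OF E]])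
  have e_eq: "e z = fderiv (\<lambda>v. h (\<kappa> (fst z, v), snd z)) p y" if "smooth_at E (z, p)" for z
    using sl3(4)[OF that, of y] by (simp add: e_def E_def)
  have h_ev: "\<forall>\<^sub>F z in nhds (p, p). smooth_at h z" by (rule smooth_at_eventually[OF h])
  have \<kappa>_ev: "\<forall>\<^sub>F z in nhds (p, p). smooth_at \<kappa> z" by (rule smooth_at_eventually[OF \<kappa>])
  \<comment> \<open>On the diagonal w = u the hypothesis \<open>conj\<close> collapses
    \<open>E\<close> to \<open>h (u, v)\<close>. The derivative along the diagonal is the sum of the
    two partial derivatives computed next.\<close>
  have lhs: "fderiv (\<lambda>z. fderiv h z (0, y)) (p, p) (x, 0) = fderiv (\<lambda>u. e (u, u)) p x"
  proof -
    have "\<forall>\<^sub>F u in nhds p. smooth_at E ((u, u), p)"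
      using isCont_eventually[where f = "\<lambda>u. (u, u)" and x = p] E_ev by simp
    then have "\<forall>\<^sub>F u in nhds p. fderiv h (u, p) (0, y) = e (u, u)"
      using ev1[OF h_ev] eventually_eventually_nhds_slice[OF conj]
    proof eventually_elim
      case (elim u)
      have "e (u, u) = fderiv (\<lambda>v. h (u, v)) p y"
        using e_eq[OF elim(1)] fderiv_eventually_cong[OF elim(3)] by simp
      then show ?case using sl(4)[OF elim(2)] by simp
    qed
    from fderiv_eventually_cong[OF this] show ?thesis
      using sl(3)[OF smooth_at_fderiv[OF h], of "(0, y)" x] by simp
  qed
  \<comment> \<open>With w = \<open>p\<close>, the right factor is the identity of the group and
    \<open>h\<close> reduces to \<open>k\<close>. As \<open>\<kappa> (u, p) = p\<close>, the outer
    derivative is always that of \<open>k\<close> at \<open>p\<close>, a linear map independent of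
    u.\<close>
  have fst_part: "fderiv e (p, p) (x, 0) = fderiv k p (fderiv (\<lambda>u. fderiv \<kappa> (u, p) (0, y)) p x)"
  proof -
    have "\<forall>\<^sub>F z in nhds (p, p). h (\<kappa> z, p) = k (\<kappa> z)"
      by (rule isCont_eventually[OF smooth_at_isCont[OF \<kappa>]]) (simp add: \<kappa>p hk)
    with ev1[OF E_ev] ev1[OF \<kappa>_ev] eventually_eventually_nhds_slice \<kappa>2
    have "\<forall>\<^sub>F u in nhds p. smooth_at E ((u, p), p) \<and> smooth_at \<kappa> (u, p) \<and> \<kappa> (u, p) = p \<and>
        (\<forall>\<^sub>F v in nhds p. h (\<kappa> (u, v), p) = k (\<kappa> (u, v)))"
      by (intro eventually_conj) auto
    then have "\<forall>\<^sub>F u in nhds p. e (u, p) = fderiv k p (fderiv \<kappa> (u, p) (0, y))"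
    proof eventually_elim
      case (elim u)
      then have "e (u, p) = fderiv (\<lambda>v. k (\<kappa> (u, v))) p y"
        using e_eq[of "(u, p)"] fderiv_eventually_cong[of "\<lambda>v. h (\<kappa> (u, v), p)" "\<lambda>v. k (\<kappa> (u, v))" p] by simp
      also have "\<dots> = fderiv k p (fderiv \<kappa> (u, p) (0, y))"
        using fderiv_compose[of k "\<lambda>v. \<kappa> (u, v)" p y] sl(2,4)[of \<kappa> u p] elim k by simp
      finally show ?case .
    qed
    from fderiv_eventually_cong[OF this]
    have "fderiv e (p, p) (x, 0) = fderiv (\<lambda>u. fderiv k p (fderiv \<kappa> (u, p) (0, y))) p x"
      using sl(3)[OF e, of x] by simp
    moreover have bl: "bounded_linear (fderiv k p)"
      using smooth_at_has_derivative[OF k] has_derivative_bounded_linear by blast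
    ultimately show ?thesis
      using fderiv_compose[OF smooth_at_bounded_linear[OF bl] sl(1)[OF smooth_at_fderiv[OF \<kappa>]], of "(0, y)" x]
      by (simp add: fderiv_bounded_linear[OF bl])
  qed
  \<comment> \<open>With u = \<open>p\<close>, conjugation is the identity map and \<open>E\<close>
    reduces to \<open>h (v, w)\<close>. It is differentiated in v first and in w second, the
    opposite of the order in the claim, hence \<open>fderiv_fderiv_commute\<close>.\<close>
  have snd_part: "fderiv e (p, p) (0, x) = fderiv (\<lambda>z. fderiv h z (0, x)) (p, p) (y, 0)"
  proof -
    have "\<forall>\<^sub>F w in nhds p. e (p, w) = fderiv h (p, w) (y, 0)"
      using ev2[OF E_ev] ev2[OF h_ev]
    proof eventually_elim
      case (elim w)
      have "\<forall>\<^sub>F v in nhds p. h (\<kappa> (p, v), w) = h (v, w)"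
        using \<kappa>1 by eventually_elim simp
      then show ?case
        using e_eq[OF elim(1)] sl(3)[OF elim(2), of y] fderiv_eventually_cong by fastforce
    qed
    from fderiv_eventually_cong[OF this]
    have "fderiv e (p, p) (0, x) = fderiv (\<lambda>w. fderiv h (p, w) (y, 0)) p x"
      using sl(4)[OF e, of x] by simp
    also have "\<dots> = fderiv (\<lambda>z. fderiv h z (y, 0)) (p, p) (0, x)"
      using sl(4)[OF smooth_at_fderiv[OF h]] .
    also have "\<dots> = fderiv (\<lambda>z. fderiv h z (0, x)) (p, p) (y, 0)"
      by (rule fderiv_fderiv_commute[OF h])
    finally show ?thesis .
  qed
  show ?thesis
    using lhs fst_part snd_part smooth_at_diagonal[OF fd e, of x] by simp
qed


section \<open>Lie groups in a chart at the identity\<close>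

locale lie_group_chart = lie_group G M + pointed_chart M U \<phi> "\<one>\<^bsub>G\<^esub>"
  for G :: "'g monoid" (structure) and M :: "('g, 'e::real_inner) manifold" and U \<phi>
begin

abbreviation p0 :: 'e where "p0 \<equiv> \<phi> \<one>"

lemma U_carrier: "q \<in> U \<Longrightarrow> q \<in> carrier G"
  using U_subset topspace_eq_carrier by auto

lemma \<phi>i_o: "\<phi>i p0 = \<one>"
  using \<phi>i_\<phi> p_in_U by simp

lemma fd: "fin_dim TYPE('e)" and fd2: "fin_dim TYPE('e \<times> 'e)"
  using model_fin_dim fin_dim_prod by auto

text \<open>The set \<open>S\<close> of coordinate pairs whose product stays in \<open>U\<close> is
  open by continuity of multiplication. It is also the domain on which \<open>smooth_mult\<close>
  gives smoothness in the product chart, once the \<open>inv_into\<close> of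
  \<open>map_prod \<phi> \<phi>\<close> is identified with the componentwise inverse.\<close>

lemma mult_in_chart:
  shows "smooth_at (\<lambda>z. \<phi> (\<phi>i (fst z) \<otimes> \<phi>i (snd z))) (p0, p0)"
    and "\<forall>\<^sub>F z in nhds (p0, p0). \<phi>i (fst z) \<otimes> \<phi>i (snd z) \<in> U"
proof -
  let ?\<Phi> = "map_prod \<phi> \<phi>"
  define S where "S = {z \<in> \<phi> ` U \<times> \<phi> ` U. \<phi>i (fst z) \<otimes> \<phi>i (snd z) \<in> U}"
  have "continuous_map (top_of_set (\<phi> ` U \<times> \<phi> ` U)) (mtop M) (\<phi>i \<circ> fst)"
    "continuous_map (top_of_set (\<phi> ` U \<times> \<phi> ` U)) (mtop M) (\<phi>i \<circ> snd)"
    by (rule continuous_map_compose[OF _ continuous_map_\<phi>i]; auto intro!: continuous_intros)+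
  then have "continuous_map (top_of_set (\<phi> ` U \<times> \<phi> ` U)) (prod_topology (mtop M) (mtop M))
      (\<lambda>z. (\<phi>i (fst z), \<phi>i (snd z)))"
    by (intro continuous_map_pairedI) (simp_all add: o_def)
  then have "continuous_map (top_of_set (\<phi> ` U \<times> \<phi> ` U))
      (subtopology (prod_topology (mtop M) (mtop M)) (carrier G \<times> carrier G))
      (\<lambda>z. (\<phi>i (fst z), \<phi>i (snd z)))"
    unfolding continuous_map_in_subtopology using U_carrier \<phi>i_in_U by auto
  moreover have "continuous_map (subtopology (prod_topology (mtop M) (mtop M)) (carrier G \<times> carrier G))
      (mtop M) (\<lambda>(g, h). g \<otimes> h)"
    using smooth_mult unfolding smooth_map_on_def prod_manifold_def by simp
  ultimately have "continuous_map (top_of_set (\<phi> ` U \<times> \<phi> ` U)) (mtop M)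
      ((\<lambda>(g, h). g \<otimes> h) \<circ> (\<lambda>z. (\<phi>i (fst z), \<phi>i (snd z))))"
    by (rule continuous_map_compose)
  from openin_continuous_map_preimage[OF this openin_U]
  have "openin (top_of_set (\<phi> ` U \<times> \<phi> ` U)) S" by (simp add: S_def)
  then have S: "open S" using openin_open_eq open_Times[OF open_image_U open_image_U] by blast
  have oS: "(p0, p0) \<in> S" using p_in_U \<phi>i_o by (simp add: S_def)
  have inj: "inj_on ?\<Phi> (U \<times> U)" using inj_on_\<phi> by (intro map_prod_inj_on)
  have inv: "inv_into (U \<times> U) ?\<Phi> z = (\<phi>i (fst z), \<phi>i (snd z))" if "z \<in> \<phi> ` U \<times> \<phi> ` U" for z
    using that by (intro inv_into_f_eq[OF inj]) (auto simp: \<phi>i_\<phi>)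
  have img: "?\<Phi> ` {q \<in> U \<times> U \<inter> carrier G \<times> carrier G. (\<lambda>(g, h). g \<otimes> h) q \<in> U} = S" (is "?\<Phi> ` ?Q = S")
  proof (intro equalityI subsetI)
    fix z assume z: "z \<in> S"
    show "z \<in> ?\<Phi> ` ?Q"
      by (rule image_eqI[of _ _ "(\<phi>i (fst z), \<phi>i (snd z))"])
        (use z U_carrier \<phi>i_in_U in \<open>auto simp: S_def \<phi>_\<phi>i prod_eq_iff\<close>)
  qed (auto simp: S_def \<phi>i_\<phi>)
  have "(U \<times> U, ?\<Phi>) \<in> charts (prod_manifold M M)"
    using chart unfolding prod_manifold_def by auto
  with smooth_mult chart have "smooth_on (?\<Phi> ` ?Q) (\<phi> \<circ> (\<lambda>(g, h). g \<otimes> h) \<circ> inv_into (U \<times> U) ?\<Phi>)"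
    unfolding smooth_map_on_def by blast
  then have "smooth_on S (\<phi> \<circ> (\<lambda>(g, h). g \<otimes> h) \<circ> inv_into (U \<times> U) ?\<Phi>)"
    unfolding img .
  then have "smooth_on S (\<lambda>z. \<phi> (\<phi>i (fst z) \<otimes> \<phi>i (snd z)))"
    by (rule smooth_on_cong[OF S]) (simp add: S_def inv)
  then show "smooth_at (\<lambda>z. \<phi> (\<phi>i (fst z) \<otimes> \<phi>i (snd z))) (p0, p0)" using S oS by (rule smooth_atI)
  show "\<forall>\<^sub>F z in nhds (p0, p0). \<phi>i (fst z) \<otimes> \<phi>i (snd z) \<in> U"
    using eventually_nhds_in_open[OF S oS] by eventually_elim (simp add: S_def)
qed

lemma inv_in_chart:
  shows "smooth_at (\<lambda>u. \<phi> (inv (\<phi>i u))) p0" and "\<forall>\<^sub>F u in nhds p0. inv (\<phi>i u) \<in> U"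
proof -
  define S where "S = {u \<in> \<phi> ` U. inv (\<phi>i u) \<in> U}"
  have "continuous_map (top_of_set (\<phi> ` U)) (subtopology (mtop M) (carrier G)) \<phi>i"
    unfolding continuous_map_in_subtopology using U_carrier \<phi>i_in_U continuous_map_\<phi>i by auto
  moreover have "continuous_map (subtopology (mtop M) (carrier G)) (mtop M) (\<lambda>g. inv g)"
    using smooth_inv unfolding smooth_map_on_def by blast
  ultimately have "continuous_map (top_of_set (\<phi> ` U)) (mtop M) ((\<lambda>g. inv g) \<circ> \<phi>i)"
    by (rule continuous_map_compose)
  from openin_continuous_map_preimage[OF this openin_U]
  have "openin (top_of_set (\<phi> ` U)) S" by (simp add: S_def)
  then have S: "open S" using openin_open_eq open_image_U by blast
  have oS: "p0 \<in> S" using p_in_U \<phi>i_o by (simp add: S_def)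
  have img: "\<phi> ` {q \<in> U \<inter> carrier G. inv q \<in> U} = S"
    using U_carrier by (force simp: S_def \<phi>i_\<phi>)
  have "smooth_on (\<phi> ` {q \<in> U \<inter> carrier G. inv q \<in> U}) (\<phi> \<circ> (\<lambda>g. inv g) \<circ> \<phi>i)"
    using smooth_inv chart unfolding smooth_map_on_def by blast
  then have "smooth_on S (\<lambda>u. \<phi> (inv (\<phi>i u)))" unfolding img by (simp add: o_def)
  then show "smooth_at (\<lambda>u. \<phi> (inv (\<phi>i u))) p0" using S oS by (rule smooth_atI)
  show "\<forall>\<^sub>F u in nhds p0. inv (\<phi>i u) \<in> U"
    using eventually_nhds_in_open[OF S oS] by eventually_elim (simp add: S_def)
qed

definition \<kappa> :: "'e \<times> 'e \<Rightarrow> 'e" where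
  "\<kappa> z = \<phi> (\<phi>i (fst z) \<otimes> \<phi>i (snd z) \<otimes> inv (\<phi>i (fst z)))"

text \<open>Conjugation is multiplication applied to the pair consisting of u v and u^-1. Passing
  through coordinates in between is faithful only where both entries lie in \<open>U\<close>, which
  holds near \<open>(p0, p0)\<close> because this pair is fixed by the inner map.\<close>

lemma conj_in_chart:
  shows "smooth_at \<kappa> (p0, p0)"
    and "\<forall>\<^sub>F z in nhds (p0, p0). \<phi>i (fst z) \<otimes> \<phi>i (snd z) \<otimes> inv (\<phi>i (fst z)) \<in> U"
proof -
  let ?\<mu> = "\<lambda>z. \<phi> (\<phi>i (fst z) \<otimes> \<phi>i (snd z))"
  let ?f = "\<lambda>z. (?\<mu> z, \<phi> (inv (\<phi>i (fst z))))"
  have oo: "?f (p0, p0) = (p0, p0)" by (simp add: \<phi>i_o)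
  have "smooth_at (\<lambda>z. \<phi> (inv (\<phi>i (fst z)))) (p0, p0)"
    by (rule smooth_at_compose[OF fd, of _ fst]) (simp_all add: inv_in_chart(1) smooth_at_bounded_linear bounded_linear_fst)
  with mult_in_chart(1) have f: "smooth_at ?f (p0, p0)" by (rule smooth_at_Pair)
  have sm: "smooth_at (\<lambda>z. ?\<mu> (?f z)) (p0, p0)"
    by (rule smooth_at_compose[OF fd2 _ f]) (use mult_in_chart(1) oo in simp)
  have 1: "\<forall>\<^sub>F z in nhds (p0, p0). \<phi>i (fst (?f z)) \<otimes> \<phi>i (snd (?f z)) \<in> U"
    by (rule isCont_eventually[OF smooth_at_isCont[OF f]]) (use mult_in_chart(2) oo in simp)
  have 2: "\<forall>\<^sub>F z in nhds (p0, p0). inv (\<phi>i (fst z)) \<in> U"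
    by (rule isCont_eventually) (simp_all add: inv_in_chart(2))
  have 3: "\<forall>\<^sub>F z in nhds (p0, p0). \<phi>i (fst (?f z)) \<otimes> \<phi>i (snd (?f z)) =
      \<phi>i (fst z) \<otimes> \<phi>i (snd z) \<otimes> inv (\<phi>i (fst z))"
    using 2 mult_in_chart(2) by eventually_elim (simp add: \<phi>i_\<phi>)
  have "\<forall>\<^sub>F z in nhds (p0, p0). ?\<mu> (?f z) = \<kappa> z"
    using 3 by eventually_elim (simp add: \<kappa>_def)
  with sm show "smooth_at \<kappa> (p0, p0)" by (rule smooth_at_cong)
  show "\<forall>\<^sub>F z in nhds (p0, p0). \<phi>i (fst z) \<otimes> \<phi>i (snd z) \<otimes> inv (\<phi>i (fst z)) \<in> U"
    using 1 3 by eventually_elim simp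
qed

lemma eventually_fst_in_chart: "\<forall>\<^sub>F z in nhds (p0, p0). fst z \<in> \<phi> ` U"
  and eventually_snd_in_chart: "\<forall>\<^sub>F z in nhds (p0, p0). snd z \<in> \<phi> ` U"
  by (rule isCont_eventually; simp add: eventually_in_chart)+

lemma \<kappa>_identity:
  shows "u \<in> \<phi> ` U \<Longrightarrow> \<kappa> (u, p0) = p0" "u \<in> \<phi> ` U \<Longrightarrow> \<kappa> (p0, u) = u"
  using \<phi>i_in_U U_carrier by (auto simp: \<kappa>_def \<phi>i_o \<phi>_\<phi>i)

section \<open>The adjoint representation and the bracket in coordinates\<close>

definition Ad_chart :: "'e \<Rightarrow> 'e \<Rightarrow> 'e" where
  "Ad_chart u y = fderiv \<kappa> (u, p0) (0, y)"

definition ad_chart :: "'e \<Rightarrow> 'e \<Rightarrow> 'e" where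
  "ad_chart x y = fderiv (\<lambda>u. Ad_chart u y) p0 x"

lemma smooth_at_Ad_chart: "smooth_at (\<lambda>u. Ad_chart u y) p0"
  unfolding Ad_chart_def by (rule smooth_at_slices(1)[OF fd fd smooth_at_fderiv[OF conj_in_chart(1)]])

lemma eventually_smooth_\<kappa>: "\<forall>\<^sub>F u in nhds p0. smooth_at \<kappa> (u, p0)"
  by (rule eventually_nhds_slices(1)[OF smooth_at_eventually[OF conj_in_chart(1)]])

text \<open>The quantifier over \<open>y\<close> stands inside \<open>eventually\<close>, since the
  neighbourhood depends on the conjugation only. The averaging identity is later used for a fixed
  group element and all \<open>y\<close> near 0.\<close>

lemma Ad_tvec: "\<forall>\<^sub>F u in nhds p0. \<forall>y. Ad G M (\<phi>i u) (tvec y) = tvec (Ad_chart u y)"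
  using eventually_in_chart eventually_smooth_\<kappa> eventually_eventually_nhds_slice[OF conj_in_chart(2)]
proof eventually_elim
  case (elim u)
  \<comment> \<open>For a group element the map \<open>?c\<close> fixes \<one>, the point near which
    \<open>differential\<close> tests smoothness.\<close>
  have g: "\<phi>i u \<in> carrier G" using elim(1) \<phi>i_in_U U_carrier by blast
  let ?c = "\<lambda>h. \<phi>i u \<otimes> h \<otimes> inv (\<phi>i u)"
  note \<kappa>u = smooth_at_slices(2,4)[OF fd fd elim(2)]
  have "Ad G M (\<phi>i u) (tvec y) f = tvec (Ad_chart u y) f" for y f
  proof (cases "smooth_near M \<one> f")
    case True
    let ?f = "\<lambda>v. f (\<phi>i v)"
    have f: "smooth_at ?f (\<kappa> (u, p0))"
      using True smooth_near_iff \<kappa>_identity(1)[OF elim(1)] by simp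
    have ev: "\<forall>\<^sub>F v in nhds p0. ?f (\<kappa> (u, v)) = (f \<circ> ?c) (\<phi>i v)"
      using elim(3) by eventually_elim (simp add: \<kappa>_def \<phi>i_\<phi>)
    have "smooth_at (\<lambda>v. ?f (\<kappa> (u, v))) p0" by (rule smooth_at_compose[OF fd f \<kappa>u(1)])
    then have "smooth_near M \<one> (f \<circ> ?c)"
      unfolding smooth_near_iff using ev by (rule smooth_at_cong)
    moreover have "fderiv (\<lambda>v. (f \<circ> ?c) (\<phi>i v)) p0 y = fderiv (\<lambda>v. ?f (\<kappa> (u, v))) p0 y"
      using fderiv_eventually_cong[OF ev] by simp
    moreover have "\<dots> = fderiv ?f p0 (Ad_chart u y)"
      using fderiv_compose[OF f \<kappa>u(1)] \<kappa>u(2) \<kappa>_identity(1)[OF elim(1)] by (simp add: Ad_chart_def)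
    ultimately show ?thesis using True g by (simp add: Ad_def differential_def tvec_eq)
  qed (use g in \<open>simp add: Ad_def differential_def tvec_def\<close>)
  then show ?case by blast
qed

lemma left_invariant_field_tvec:
  assumes f: "smooth_near M \<one> f"
  defines "h \<equiv> \<lambda>z. f (\<phi>i (fst z) \<otimes> \<phi>i (snd z))"
  shows "smooth_at h (p0, p0)"
    and "\<forall>\<^sub>F u in nhds p0. left_invariant_field G M (tvec y) (\<phi>i u) f = fderiv h (u, p0) (0, y)"
proof -
  let ?\<mu> = "\<lambda>z. \<phi> (\<phi>i (fst z) \<otimes> \<phi>i (snd z))"
  have fo: "smooth_at (\<lambda>u. f (\<phi>i u)) (?\<mu> (p0, p0))" using f smooth_near_iff by (simp add: \<phi>i_o)
  have "smooth_at (\<lambda>z. f (\<phi>i (?\<mu> z))) (p0, p0)"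
    by (rule smooth_at_compose[OF fd fo mult_in_chart(1)])
  moreover have "\<forall>\<^sub>F z in nhds (p0, p0). f (\<phi>i (?\<mu> z)) = h z"
    using mult_in_chart(2) by eventually_elim (simp add: h_def \<phi>i_\<phi>)
  ultimately show h: "smooth_at h (p0, p0)" by (rule smooth_at_cong)
  \<comment> \<open>The field is evaluated at \<open>\<phi>i u\<close>, so
    \<open>differential\<close> tests smoothness there. The open set \<open>W\<close> witnesses it
    for all these points at once and excludes the default value 0.\<close>
  obtain W where W: "\<one> \<in> W" "smooth_map_on W M euclid f" using f unfolding smooth_near_def by blast
  then have "\<forall>\<^sub>F u in nhds p0. u \<in> \<phi> ` U \<and> \<phi>i u \<in> W"
    using p_in_U \<phi>i_o by (intro eventually_chart) (auto simp: smooth_map_on_def)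
  with eventually_nhds_slices(1)[OF smooth_at_eventually[OF h]]
  show "\<forall>\<^sub>F u in nhds p0. left_invariant_field G M (tvec y) (\<phi>i u) f = fderiv h (u, p0) (0, y)"
  proof eventually_elim
    case (elim u)
    have g: "\<phi>i u \<in> carrier G" using elim(2) \<phi>i_in_U U_carrier by blast
    have "smooth_near M (\<phi>i u) f" using elim(2) W unfolding smooth_near_def by blast
    moreover have "smooth_near M \<one> (f \<circ> (\<lambda>q. \<phi>i u \<otimes> q))"
      unfolding smooth_near_iff using smooth_at_slices(2)[OF fd fd elim(1)] by (simp add: h_def)
    ultimately show ?case
      using g smooth_at_slices(4)[OF fd fd elim(1), of y]
      by (simp add: left_invariant_field_def differential_def tvec_eq h_def)
  qed
qed

text \<open>Left multiplication by \<open>\<one>\<close> is the identity on the carrier only.\<close>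

lemma left_invariant_field_one: "left_invariant_field G M (tvec x) \<one> = tvec x"
proof
  fix f :: "'g \<Rightarrow> real"
  have ev: "\<forall>\<^sub>F u in nhds p0. f (\<phi>i u) = (f \<circ> (\<lambda>q. \<one> \<otimes> q)) (\<phi>i u)"
    using eventually_in_chart
  proof eventually_elim
    case (elim u)
    then have "\<phi>i u \<in> carrier G" using \<phi>i_in_U U_carrier by blast
    then show ?case by simp
  qed
  show "left_invariant_field G M (tvec x) \<one> f = tvec x f"
  proof (cases "smooth_near M \<one> f")
    case True
    then have "smooth_near M \<one> (f \<circ> (\<lambda>q. \<one> \<otimes> q))"
      unfolding smooth_near_iff using ev by (rule smooth_at_cong)
    with True show ?thesis
      using fderiv_eventually_cong[OF ev] by (simp add: left_invariant_field_def differential_def tvec_eq)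
  qed (simp add: left_invariant_field_def differential_def tvec_def)
qed

text \<open>With \<open>h\<close> the coordinate form of (g, q) |-> f (g q), a left invariant field
  differentiates \<open>h\<close> in the second variable, and the outer tangent vector
  differentiates the result in the first. The bracket is thus a difference of mixed second
  derivatives of \<open>h\<close>, which \<open>commutator_derivative\<close> evaluates with
  \<open>f\<close> in coordinates as \<open>k\<close>.\<close>

lemma lie_bracket_tvec: "lie_bracket G M (tvec x) (tvec y) = tvec (ad_chart x y)"
proof
  fix f
  show "lie_bracket G M (tvec x) (tvec y) f = tvec (ad_chart x y) f"
  proof (cases "smooth_near M \<one> f")
    case True
    define h where "h = (\<lambda>z. f (\<phi>i (fst z) \<otimes> \<phi>i (snd z)))"
    note h = left_invariant_field_tvec(1)[OF True, folded h_def]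
    have field: "tvec v (\<lambda>q. left_invariant_field G M (tvec w) q f) =
        fderiv (\<lambda>z. fderiv h z (0, w)) (p0, p0) (v, 0)" for v w
    proof -
      have ev: "\<forall>\<^sub>F u in nhds p0. fderiv h (u, p0) (0, w) = left_invariant_field G M (tvec w) (\<phi>i u) f"
        using left_invariant_field_tvec(2)[OF True, of w, folded h_def] by eventually_elim simp
      note sl = smooth_at_slices(1,3)[OF fd fd smooth_at_fderiv[OF h]]
      have "smooth_near M \<one> (\<lambda>q. left_invariant_field G M (tvec w) q f)"
        unfolding smooth_near_iff by (rule smooth_at_cong[OF sl(1) ev])
      moreover have "fderiv (\<lambda>u. left_invariant_field G M (tvec w) (\<phi>i u) f) p0 v =
          fderiv (\<lambda>z. fderiv h z (0, w)) (p0, p0) (v, 0)"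
        using fderiv_eventually_cong[OF ev] sl(2)[of "(0, w)" v] by simp
      ultimately show ?thesis by (simp add: tvec_eq)
    qed
    have "fderiv (\<lambda>z. fderiv h z (0, y)) (p0, p0) (x, 0) - fderiv (\<lambda>z. fderiv h z (0, x)) (p0, p0) (y, 0)
      = fderiv (\<lambda>u. f (\<phi>i u)) p0 (fderiv (\<lambda>u. fderiv \<kappa> (u, p0) (0, y)) p0 x)"
    proof (rule commutator_derivative[OF fd h conj_in_chart(1)])
      show "smooth_at (\<lambda>u. f (\<phi>i u)) p0" using True smooth_near_iff by simp
      show "\<forall>\<^sub>F z in nhds (p0, p0). h (\<kappa> z, fst z) = h z"
        using conj_in_chart(2) eventually_fst_in_chart eventually_snd_in_chart
      proof eventually_elim
        case (elim z)
        have "\<phi>i (fst z) \<in> carrier G" "\<phi>i (snd z) \<in> carrier G"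
          using elim \<phi>i_in_U U_carrier by blast+
        then show ?case using elim(1) by (simp add: h_def \<kappa>_def \<phi>i_\<phi> m_assoc)
      qed
      show "\<forall>\<^sub>F v in nhds p0. \<kappa> (p0, v) = v" "\<forall>\<^sub>F u in nhds p0. \<kappa> (u, p0) = p0"
        using eventually_in_chart by (eventually_elim, simp add: \<kappa>_identity)+
      show "\<forall>\<^sub>F v in nhds p0. h (v, p0) = f (\<phi>i v)"
        using eventually_in_chart
      proof eventually_elim
        case (elim v)
        then have "\<phi>i v \<in> carrier G" using \<phi>i_in_U U_carrier by blast
        then show ?case by (simp add: h_def \<phi>i_o)
      qed
    qed
    then show ?thesis
      using True by (simp add: lie_bracket_def field_bracket_def left_invariant_field_one field tvec_eq ad_chart_def Ad_chart_def)
  qed (simp add: lie_bracket_def field_bracket_def tvec_def)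
qed

end


section \<open>Relative averaging operators\<close>

locale averaging_chart = lie_group_chart +
  fixes \<BB>
  assumes smooth_\<BB>: "smooth_map_on (lie_algebra G M) (lie_algebra_manifold G M) M \<BB>"
    and pointed: "\<BB> (\<lambda>f. 0) = \<one>\<^bsub>G\<^esub>"
    and averaging: "relative_averaging_operator G M \<BB>"
begin

text \<open>Here \<open>'b\<close> is the model space: the argument of \<BB> is read through
  \<open>tvec\<close> and its value through \<phi>.\<close>

definition \<beta> :: "'b \<Rightarrow> 'b" where
  "\<beta> u = \<phi> (\<BB> (tvec u))"

definition d\<beta> :: "'b \<Rightarrow> 'b" where
  "d\<beta> = fderiv \<beta> 0"

lemma smooth_at_\<beta>: "smooth_at \<beta> 0" and eventually_\<BB>_in_U: "\<forall>\<^sub>F u in nhds 0. \<BB> (tvec u) \<in> U"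
  using smooth_at_from_linear_manifold(1,2)[OF smooth_\<BB>[unfolded lie_algebra_manifold_def lie_algebra_def]
      linear_iso_tvec pointed]
  unfolding \<beta>_def[abs_def] by auto

lemma \<beta>_0: "\<beta> 0 = p0"
  by (simp add: \<beta>_def tvec_0 pointed)

lemma differential_at_zero_tvec: "differential_at_zero G M \<BB> (tvec w) = tvec (d\<beta> w)"
  using differential_linear_manifold[OF smooth_\<BB>[unfolded lie_algebra_manifold_def lie_algebra_def] pointed, of w]
  unfolding differential_at_zero_def tangent_at_zero_def lie_algebra_manifold_def lie_algebra_def
    d\<beta>_def \<beta>_def[abs_def] .

text \<open>For each x near 0 the averaging identity is an identity of germs in y at 0, and both
  sides are differentiated there. It is kept on a neighbourhood of x = 0 so that it can be
  differentiated in x afterwards.\<close>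

lemma Ad_chart_d\<beta>: "\<forall>\<^sub>F x in nhds 0. Ad_chart (\<beta> x) (d\<beta> y) = d\<beta> (Ad_chart (\<beta> x) y)"
proof -
  have cont: "isCont \<beta> 0" by (rule smooth_at_isCont[OF smooth_at_\<beta>])
  have "\<forall>\<^sub>F x in nhds 0. smooth_at \<kappa> (\<beta> x, p0) \<and>
      (\<forall>y. Ad G M (\<phi>i (\<beta> x)) (tvec y) = tvec (Ad_chart (\<beta> x) y))"
    by (rule isCont_eventually[OF cont]) (simp add: \<beta>_0 eventually_conj eventually_smooth_\<kappa> Ad_tvec)
  with eventually_\<BB>_in_U show ?thesis
  proof eventually_elim
    case (elim x)
    note \<kappa>x = smooth_at_slices(2,4)[OF fd fd conjunct1[OF elim(2)]]
    have \<BB>x: "\<phi>i (\<beta> x) = \<BB> (tvec x)" using elim(1) by (simp add: \<beta>_def \<phi>i_\<phi>)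
    have "\<forall>\<^sub>F y in nhds 0. \<kappa> (\<beta> x, \<beta> y) = \<beta> (Ad_chart (\<beta> x) y)"
      using eventually_\<BB>_in_U
    proof eventually_elim
      case (elim y)
      have "\<BB> (tvec x) \<otimes> \<BB> (tvec y) \<otimes> inv (\<BB> (tvec x)) = \<BB> (Ad G M (\<BB> (tvec x)) (tvec y))"
        using averaging tvec_in_tangent_space unfolding relative_averaging_operator_def lie_algebra_def by blast
      also have "Ad G M (\<BB> (tvec x)) (tvec y) = tvec (Ad_chart (\<beta> x) y)"
        using \<open>_ \<and> (\<forall>y. Ad G M (\<phi>i (\<beta> x)) (tvec y) = tvec (Ad_chart (\<beta> x) y))\<close> \<BB>x by metis
      finally show ?case
        using elim \<BB>x by (simp add: \<kappa>_def \<beta>_def \<phi>i_\<phi>)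
    qed
    from fderiv_eventually_cong[OF this]
    have eq: "fderiv (\<lambda>y. \<kappa> (\<beta> x, \<beta> y)) 0 y = fderiv (\<lambda>y. \<beta> (Ad_chart (\<beta> x) y)) 0 y" by simp
    have \<kappa>x': "smooth_at (\<lambda>v. \<kappa> (\<beta> x, v)) (\<beta> 0)" using \<kappa>x(1) by (simp add: \<beta>_0)
    have "fderiv (\<lambda>y. \<kappa> (\<beta> x, \<beta> y)) 0 y = Ad_chart (\<beta> x) (d\<beta> y)"
      using fderiv_compose[OF \<kappa>x' smooth_at_\<beta>, of y] \<kappa>x(2) by (simp add: \<beta>_0 Ad_chart_def d\<beta>_def)
    moreover have "fderiv (\<lambda>y. \<beta> (Ad_chart (\<beta> x) y)) 0 y = d\<beta> (Ad_chart (\<beta> x) y)"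
    proof -
      \<comment> \<open>Linearity gives both that the inner map sends 0 to 0 and that it is its own
        derivative.\<close>
      have l: "linear (Ad_chart (\<beta> x))"
        using smooth_at_linear[OF \<kappa>x(1)] by (simp add: Ad_chart_def[abs_def] \<kappa>x(2)[abs_def])
      then have bl: "bounded_linear (Ad_chart (\<beta> x))" by (rule fin_dim_bounded_linear[OF fd])
      have "smooth_at \<beta> (Ad_chart (\<beta> x) 0)" using smooth_at_\<beta> linear_0[OF l] by simp
      from fderiv_compose[OF this smooth_at_bounded_linear[OF bl]] show ?thesis
        by (simp add: fderiv_bounded_linear[OF bl] linear_0[OF l] d\<beta>_def)
    qed
    ultimately show ?case using eq by simp
  qed
qed

text \<open>Since \<beta> 0 is \<open>p0\<close>, the chain rule produces the derivative of
  \<open>Ad_chart\<close> at the identity in the direction \<open>d\<beta> x\<close>; on the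
  right-hand side the bounded linear map \<open>d\<beta>\<close> commutes with
  differentiation.\<close>

lemma ad_chart_d\<beta>: "ad_chart (d\<beta> x) (d\<beta> y) = d\<beta> (ad_chart (d\<beta> x) y)"
proof -
  have Ad: "smooth_at (\<lambda>u. Ad_chart u y) (\<beta> 0)" for y using smooth_at_Ad_chart by (simp add: \<beta>_0)
  have Ad_\<beta>: "fderiv (\<lambda>x. Ad_chart (\<beta> x) y) 0 x = ad_chart (d\<beta> x) y" for y
    using fderiv_compose[OF Ad smooth_at_\<beta>] by (simp add: ad_chart_def d\<beta>_def \<beta>_0)
  have bl: "bounded_linear d\<beta>"
    unfolding d\<beta>_def using smooth_at_has_derivative[OF smooth_at_\<beta>] has_derivative_bounded_linear by blast
  have "fderiv (\<lambda>x. d\<beta> (Ad_chart (\<beta> x) y)) 0 x = d\<beta> (fderiv (\<lambda>x. Ad_chart (\<beta> x) y) 0 x)"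
    using fderiv_compose[OF smooth_at_bounded_linear[OF bl] smooth_at_compose[OF fd Ad smooth_at_\<beta>]]
    by (simp add: fderiv_bounded_linear[OF bl])
  then show ?thesis using fderiv_eventually_cong[OF Ad_chart_d\<beta>, of y] Ad_\<beta> by metis
qed

lemma averaging_operator_differential:
  "averaging_operator (lie_algebra G M) (lie_bracket G M) (differential_at_zero G M \<BB>)"
proof -
  have V: "lie_algebra G M = range tvec"
    unfolding lie_algebra_def by (rule tangent_space_eq)
  have l: "linear d\<beta>" unfolding d\<beta>_def by (rule smooth_at_linear[OF smooth_at_\<beta>])
  show ?thesis
    unfolding averaging_operator_def V
    by (auto simp: differential_at_zero_tvec lie_bracket_tvec ad_chart_d\<beta> linear_add[OF l] linear_cmul[OF l]
        simp flip: tvec_linear)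
qed

end

theorem theorem2p29:
  fixes G :: "'g monoid"
    and M :: "('g, 'e::real_inner) manifold"
    and \<BB> :: "'g tvec \<Rightarrow> 'g"
  assumes "lie_group G M"
    and "smooth_map_on (lie_algebra G M) (lie_algebra_manifold G M) M \<BB>"
    and "\<BB> (\<lambda>f. 0) = \<one>\<^bsub>G\<^esub>"
    and "relative_averaging_operator G M \<BB>"
  shows "averaging_operator (lie_algebra G M) (lie_bracket G M) (differential_at_zero G M \<BB>)"
proof -
  interpret lie_group G M by fact
  have "\<one>\<^bsub>G\<^esub> \<in> topspace (mtop M)" by (simp add: topspace_eq_carrier)
  then obtain U \<phi> where "(U, \<phi>) \<in> charts M" "\<one>\<^bsub>G\<^esub> \<in> U" unfolding charts_cover by auto
  with assms interpret averaging_chart G M U \<phi> \<BB> by unfold_locales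
  show ?thesis by (rule averaging_operator_differential)
qed

end
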